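(* Let $\mathcal A_{\infty}$ be a $\mathbb C$-subalgebra of $\mathcal B_{\infty}$ with $\mathcal A_{\infty}\subset(\mathcal B_{\infty}\setminus\mathcal I_{\infty})\cup\{0\}$, and let $\mathcal H_\infty$ be as defined in the context. Let $L\in\widetilde{\mathcal E}_{\infty}$. Then: (1) The map $F_L:\mathcal H_{\infty}\to\mathcal O_{\infty}$, $\alpha\mapsto F_L(\alpha)=\sum_{n=1}^{\infty}\alpha(n)(z)L(n)(z)$, is an injective morphism of $\mathcal A_{\infty}$-modules. (2) If moreover $L(ab)=L(a)L(b)$ for all $a,b\in\mathbb N$ and $L\neq 0$, then $F_L:\mathcal H_\infty\to\mathcal O_\infty$ is an injective morphism of $\mathcal A_{\infty}$-algebras.
   Context: $\mathbb N=\{1,2,\dots\}$. For a commutative ring $R$, $\Omega(\mathbb N,R)$ is the set of maps $\mathbb N\to R$, a commutative ring (an $R$-algebra) under pointwise addition and Dirichlet convolution $(\alpha\cdot\beta)(n)=\sum_{ab=n}\alpha(a)\beta(b)$. For $k\in\mathbb R$, $\mathcal O_k$ is the ring of holomorphic functions on $\{\operatorname{Re} z>k\}$; restriction $\mathcal O_k\to\mathcal O_{k'}$ ($k\le k'$) is injective and $\mathcal O_\infty=\bigcup_k\mathcal O_k$ is the direct limit (functions holomorphic on some right half-plane, identified when they agree on a common right half-plane). $\mathcal B_k=\{f\in\mathcal O_k:\ \lim_{x\to+\infty}e^{-ax}|f(x)|=0\ \forall a>0\}$, $\mathcal I_k=\{f\in\mathcal O_k:\ \exists a>0,\ \lim_{x\to+\infty}e^{ax}|f(x)|=0\}$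 (limits along the real axis), $\mathcal B_\infty=\bigcup_k\mathcal B_k$, $\mathcal I_\infty=\bigcup_k\mathcal I_k$. Put $\mathcal A_k=\mathcal A_\infty\cap\mathcal O_k$. $\mathcal H_k$ is the set of $\alpha\in\Omega(\mathbb N,\mathcal A_k)$ for which there is a continuous $M:\{\operatorname{Re} z>k\}\to[0,\infty)$ with (i) $|\alpha(n)(z)|\le M(z)n^k$ for all $n\ge1$, $\operatorname{Re} z>k$, and (ii) $\lim_{x\to+\infty}e^{-ax}M(x)=0$ for all $a>0$; $\mathcal H_\infty=\bigcup_k\mathcal H_k$ (an $\mathcal A_\infty$-algebra under the operations above). $\mathcal E_k$ is the set of $L\in\Omega(\mathbb N,\mathcal O_k)$ for which there are a constant $c>0$ and a continuous $C:\{\operatorname{Re} z>k\}\to[0,\infty)$ with $|L(n)(z)|\le C(z)n^{-c\operatorname{Re} z}$ for all $n\ge1$, $\operatorname{Re} z>k$. $\widetilde{\mathcal E}_k$ is the set of $L\in\mathcal E_k$ such that $L(n)(z)\ne0$ for all $n\ge1$, $\operatorname{Re} z>k$, and for every $n_0\ge1$ there is $C(n_0)>0$ with $|L(n)(z)|/|L(n_0)(z)|\le n^{-C(n_0)\operatorname{Re} z}$ for all $n\ge n_0+1$, $\operatorname{Re} z>k$. $\widetilde{\mathcal E}_\infty=\bigcup_k\widetilde{\mathcal E}_k$. For such $L$ and $\alpha\in\mathcal H_\infty$ the series $F_L(\alpha)(z)=\sum_{n\ge1}\alpha(n)(z)L(n)(z)$ converges absolutely and locally uniformly on some right half-plane and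 is regarded as an element of $\mathcal O_\infty$. *)

theory Defs
  imports "HOL-Complex_Analysis.Complex_Analysis" "HOL-Algebra.Module" "HOL-Algebra.Subrings"
begin

section \<open>Holomorphic functions on right half-planes\<close>

definition halfplane :: "real \<Rightarrow> complex set" where
  "halfplane k = {z. Re z > k}"

lemma open_halfplane [simp]: "open (halfplane k)"
  by (simp add: halfplane_def open_halfspace_Re_gt)

lemma connected_halfplane [simp]: "connected (halfplane k)"
  by (simp add: halfplane_def convex_connected convex_halfspace_Re_gt)

lemma halfplane_mono: "k \<le> k' \<Longrightarrow> halfplane k' \<subseteq> halfplane k"
  by (auto simp: halfplane_def)

lemma holomorphic_eq_on_halfplane:
  assumes f: "f holomorphic_on halfplane k" and g: "g holomorphic_on halfplane k"
    and eq: "\<And>z. z \<in> halfplane l \<Longrightarrow> f z = g z" and z: "z \<in> halfplane k"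
  shows "f z = g z"
proof -
  define m where "m = max k l"
  have sub: "halfplane m \<subseteq> halfplane k" "halfplane m \<subseteq> halfplane l"
    by (auto simp: m_def intro!: halfplane_mono)
  have in1: "complex_of_real (m + 1) \<in> halfplane m" by (simp add: halfplane_def)
  have "complex_of_real (m + 1) islimpt halfplane m"
    by (rule interior_limit_point) (use in1 in \<open>simp add: interior_open\<close>)
  then have "(\<lambda>z. f z - g z) z = 0"
    using f g sub in1 eq z
    by (intro analytic_continuation[of "\<lambda>z. f z - g z" "halfplane k" "halfplane m"
          "complex_of_real (m + 1)" z])
      (auto intro!: holomorphic_intros)
  then show ?thesis by simp
qed

text \<open>The direct limit of the rings of holomorphic functions on \<^term>\<open>halfplane k\<close>:
  functions holomorphic on some right half-plane, identified when they agree on a common one.\<close>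

definition germ_rel :: "(complex \<Rightarrow> complex) \<Rightarrow> (complex \<Rightarrow> complex) \<Rightarrow> bool" where
  "germ_rel f g \<longleftrightarrow> (\<exists>k. f holomorphic_on halfplane k \<and> g holomorphic_on halfplane k \<and>
     (\<forall>z\<in>halfplane k. f z = g z))"

lemma germ_rel_common:
  assumes "germ_rel f g"
  obtains k where "\<And>k'. k' \<ge> k \<Longrightarrow> f holomorphic_on halfplane k' \<and> g holomorphic_on halfplane k' \<and>
     (\<forall>z\<in>halfplane k'. f z = g z)"
  using assms unfolding germ_rel_def
  by (metis halfplane_mono holomorphic_on_subset subsetD)

lemma germ_rel_refl: "f holomorphic_on halfplane k \<Longrightarrow> germ_rel f f"
  by (auto simp: germ_rel_def)

lemma germ_rel_part_equivp: "part_equivp germ_rel"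
proof (rule part_equivpI)
  show "\<exists>f. germ_rel f f"
    by (rule exI[of _ "\<lambda>_. 0"]) (auto intro: germ_rel_refl)
  show "symp germ_rel" unfolding symp_def germ_rel_def by metis
  show "transp germ_rel"
  proof (rule transpI)
    fix f g h assume "germ_rel f g" "germ_rel g h"
    obtain k1 where 1: "\<And>k'. k' \<ge> k1 \<Longrightarrow> f holomorphic_on halfplane k' \<and>
        g holomorphic_on halfplane k' \<and> (\<forall>z\<in>halfplane k'. f z = g z)"
      using germ_rel_common[OF \<open>germ_rel f g\<close>] by blast
    obtain k2 where 2: "\<And>k'. k' \<ge> k2 \<Longrightarrow> g holomorphic_on halfplane k' \<and>
        h holomorphic_on halfplane k' \<and> (\<forall>z\<in>halfplane k'. g z = h z)"
      using germ_rel_common[OF \<open>germ_rel g h\<close>] by blast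
    show "germ_rel f h" unfolding germ_rel_def
      by (rule exI[of _ "max k1 k2"]) (use 1[of "max k1 k2"] 2[of "max k1 k2"] in auto)
  qed
qed

quotient_type hgerm = "complex \<Rightarrow> complex" / partial: germ_rel
  morphisms rep_germ germ
  by (rule germ_rel_part_equivp)

lemma germ_rel_binop:
  assumes "germ_rel f f'" "germ_rel g g'"
    and hol: "\<And>u v k. u holomorphic_on halfplane k \<Longrightarrow> v holomorphic_on halfplane k \<Longrightarrow>
      (\<lambda>z. h (u z) (v z)) holomorphic_on halfplane k"
  shows "germ_rel (\<lambda>z. h (f z) (g z)) (\<lambda>z. h (f' z) (g' z))"
proof -
  obtain k1 where 1: "\<And>k'. k' \<ge> k1 \<Longrightarrow> f holomorphic_on halfplane k' \<and>
      f' holomorphic_on halfplane k' \<and> (\<forall>z\<in>halfplane k'. f z = f' z)"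
    using germ_rel_common[OF assms(1)] by blast
  obtain k2 where 2: "\<And>k'. k' \<ge> k2 \<Longrightarrow> g holomorphic_on halfplane k' \<and>
      g' holomorphic_on halfplane k' \<and> (\<forall>z\<in>halfplane k'. g z = g' z)"
    using germ_rel_common[OF assms(2)] by blast
  show ?thesis unfolding germ_rel_def
    by (rule exI[of _ "max k1 k2"])
      (use 1[of "max k1 k2"] 2[of "max k1 k2"] in \<open>auto intro!: hol\<close>)
qed

lift_definition const_germ :: "complex \<Rightarrow> hgerm" is "\<lambda>c _. c"
  by (auto simp: germ_rel_def)

instantiation hgerm :: comm_ring_1
begin

lift_definition zero_hgerm :: hgerm is "\<lambda>_. 0" by (auto simp: germ_rel_def)
lift_definition one_hgerm :: hgerm is "\<lambda>_. 1" by (auto simp: germ_rel_def)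
lift_definition plus_hgerm :: "hgerm \<Rightarrow> hgerm \<Rightarrow> hgerm" is "\<lambda>f g z. f z + g z"
  by (erule (1) germ_rel_binop) (rule holomorphic_on_add)
lift_definition minus_hgerm :: "hgerm \<Rightarrow> hgerm \<Rightarrow> hgerm" is "\<lambda>f g z. f z - g z"
  by (erule (1) germ_rel_binop) (rule holomorphic_on_diff)
lift_definition times_hgerm :: "hgerm \<Rightarrow> hgerm \<Rightarrow> hgerm" is "\<lambda>f g z. f z * g z"
  by (erule (1) germ_rel_binop) (rule holomorphic_on_mult)
lift_definition uminus_hgerm :: "hgerm \<Rightarrow> hgerm" is "\<lambda>f z. - f z"
  unfolding germ_rel_def by (metis holomorphic_on_minus)

instance
proof
  have add: "germ_rel (\<lambda>z. f z + g z) (\<lambda>z. f z + g z)" if "germ_rel f f" "germ_rel g g" for f g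
    by (rule germ_rel_binop[OF that]) (rule holomorphic_on_add)
  have mult: "germ_rel (\<lambda>z. f z * g z) (\<lambda>z. f z * g z)" if "germ_rel f f" "germ_rel g g" for f g
    by (rule germ_rel_binop[OF that]) (rule holomorphic_on_mult)
  have diff: "germ_rel (\<lambda>z. f z - g z) (\<lambda>z. f z - g z)" if "germ_rel f f" "germ_rel g g" for f g
    by (rule germ_rel_binop[OF that]) (rule holomorphic_on_diff)
  have const: "germ_rel (\<lambda>_. c) (\<lambda>_. c)" for c
    by (auto simp: germ_rel_def)
  fix a b c :: hgerm
  show "a * b * c = a * (b * c)"
    by transfer (simp add: mult.assoc mult)
  show "a * b = b * a"
    by transfer (simp add: mult.commute mult)
  show "1 * a = a"
    by transfer simp
  show "a + b + c = a + (b + c)"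
    by transfer (simp add: add.assoc add)
  show "a + b = b + a"
    by transfer (simp add: add.commute add)
  show "0 + a = a"
    by transfer simp
  show "- a + a = 0"
    by transfer (simp add: const)
  show "a - b = a + - b"
    by transfer (simp add: diff)
  show "(a + b) * c = a * c + b * c"
    by transfer (simp add: distrib_right add mult)
  show "(0::hgerm) \<noteq> 1"
  proof transfer
    have "complex_of_real (k + 1) \<in> halfplane k" for k by (simp add: halfplane_def)
    then show "\<not> germ_rel (\<lambda>_. 0) (\<lambda>_. 1)"
      by (auto simp: germ_rel_def)
  qed
qed

end

lemma germ_eq_iff:
  assumes "f holomorphic_on halfplane k" "g holomorphic_on halfplane l"
  shows "germ f = germ g \<longleftrightarrow> germ_rel f g"
  using Quotient_rel[OF Quotient_hgerm, of f g] germ_rel_refl[OF assms(1)] germ_rel_refl[OF assms(2)]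
  by auto

definition hol_germs :: "real \<Rightarrow> hgerm set" where
  "hol_germs k = {germ f | f. f holomorphic_on halfplane k}"

text \<open>The value at \<open>z\<close> of an element of \<^term>\<open>hol_germs k\<close> with \<open>k < Re z\<close>. By the identity
  theorem it depends neither on \<open>k\<close> nor on the representative.\<close>

definition germ_eval :: "hgerm \<Rightarrow> complex \<Rightarrow> complex" where
  "germ_eval f z = (THE w. \<exists>k g. k < Re z \<and> g holomorphic_on halfplane k \<and> f = germ g \<and> w = g z)"

lemma germ_eval_germ:
  assumes f: "f holomorphic_on halfplane k" and z: "z \<in> halfplane k"
  shows "germ_eval (germ f) z = f z"
  unfolding germ_eval_def
proof (rule the_equality)
  show "\<exists>k g. k < Re z \<and> g holomorphic_on halfplane k \<and> germ f = germ g \<and> f z = g z"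
    using f z by (auto simp: halfplane_def)
next
  fix w assume "\<exists>k g. k < Re z \<and> g holomorphic_on halfplane k \<and> germ f = germ g \<and> w = g z"
  then obtain l g where g: "l < Re z" "g holomorphic_on halfplane l" "germ f = germ g" "w = g z"
    by blast
  have "germ_rel f g" using germ_eq_iff[OF f g(2)] g(3) by simp
  then obtain m where m: "\<And>z. z \<in> halfplane m \<Longrightarrow> f z = g z"
    unfolding germ_rel_def by blast
  have "f z = g z"
  proof (rule holomorphic_eq_on_halfplane[where f = f and g = g and z = z and k = "max k l" and l = m])
    show "f holomorphic_on halfplane (max k l)"
      by (rule holomorphic_on_subset[OF f]) (simp add: halfplane_mono)
    show "g holomorphic_on halfplane (max k l)"
      by (rule holomorphic_on_subset[OF g(2)]) (simp add: halfplane_mono)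
    show "z \<in> halfplane (max k l)" using z g(1) by (simp add: halfplane_def)
    show "f z = g z" if "z \<in> halfplane m" for z by (rule m[OF that])
  qed
  then show "w = f z" using g(4) by simp
qed

lemma germ_eval_holomorphic:
  assumes "f \<in> hol_germs k"
  shows "germ_eval f holomorphic_on halfplane k"
proof -
  obtain g where g: "f = germ g" "g holomorphic_on halfplane k"
    using assms by (auto simp: hol_germs_def)
  then show ?thesis
    using germ_eval_germ[OF g(2)] by (metis holomorphic_cong)
qed

lemma germ_germ_eval:
  assumes "f \<in> hol_germs k"
  shows "germ (germ_eval f) = f"
proof -
  obtain g where g: "f = germ g" "g holomorphic_on halfplane k"
    using assms by (auto simp: hol_germs_def)
  show ?thesis unfolding g(1)
    using germ_eval_holomorphic[OF assms] g germ_eval_germ[OF g(2)]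
    by (subst germ_eq_iff) (auto simp: germ_rel_def)
qed

definition B_germs :: "real \<Rightarrow> hgerm set" where
  "B_germs k = {f \<in> hol_germs k.
     \<forall>a>0. ((\<lambda>x. exp (- a * x) * norm (germ_eval f (complex_of_real x))) \<longlongrightarrow> 0) at_top}"

definition I_germs :: "real \<Rightarrow> hgerm set" where
  "I_germs k = {f \<in> hol_germs k.
     \<exists>a>0. ((\<lambda>x. exp (a * x) * norm (germ_eval f (complex_of_real x))) \<longlongrightarrow> 0) at_top}"

definition B_inf :: "hgerm set" where "B_inf = (\<Union>k. B_germs k)"
definition I_inf :: "hgerm set" where "I_inf = (\<Union>k. I_germs k)"


section \<open>Arithmetic functions with values in germs\<close>

text \<open>Maps defined on \<open>{1, 2, \<dots>}\<close> are represented by functions on \<^typ>\<open>nat\<close> vanishing at \<open>0\<close>.\<close>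

definition Omega :: "hgerm set \<Rightarrow> (nat \<Rightarrow> hgerm) set" where
  "Omega R = {\<alpha>. \<alpha> 0 = 0 \<and> (\<forall>n\<ge>1. \<alpha> n \<in> R)}"

definition dirichlet_conv :: "(nat \<Rightarrow> hgerm) \<Rightarrow> (nat \<Rightarrow> hgerm) \<Rightarrow> nat \<Rightarrow> hgerm" where
  "dirichlet_conv \<alpha> \<beta> n = (\<Sum>(a, b) \<in> {(a, b). a \<ge> 1 \<and> b \<ge> 1 \<and> a * b = n}. \<alpha> a * \<beta> b)"

definition H_set :: "hgerm set \<Rightarrow> real \<Rightarrow> (nat \<Rightarrow> hgerm) set" where
  "H_set A k = {\<alpha> \<in> Omega (A \<inter> hol_germs k).
     \<exists>M :: complex \<Rightarrow> real. continuous_on (halfplane k) M \<and> (\<forall>z\<in>halfplane k. M z \<ge> 0) \<and>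
       (\<forall>n\<ge>1. \<forall>z\<in>halfplane k. norm (germ_eval (\<alpha> n) z) \<le> M z * real n powr k) \<and>
       (\<forall>a>0. ((\<lambda>x. exp (- a * x) * M (complex_of_real x)) \<longlongrightarrow> 0) at_top)}"

definition H_inf :: "hgerm set \<Rightarrow> (nat \<Rightarrow> hgerm) set" where
  "H_inf A = (\<Union>k. H_set A k)"

definition E_set :: "real \<Rightarrow> (nat \<Rightarrow> hgerm) set" where
  "E_set k = {L \<in> Omega (hol_germs k).
     \<exists>c>0. \<exists>C :: complex \<Rightarrow> real. continuous_on (halfplane k) C \<and> (\<forall>z\<in>halfplane k. C z \<ge> 0) \<and>
       (\<forall>n\<ge>1. \<forall>z\<in>halfplane k. norm (germ_eval (L n) z) \<le> C z * real n powr (- c * Re z))}"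

definition Et_set :: "real \<Rightarrow> (nat \<Rightarrow> hgerm) set" where
  "Et_set k = {L \<in> E_set k.
     (\<forall>n\<ge>1. \<forall>z\<in>halfplane k. germ_eval (L n) z \<noteq> 0) \<and>
     (\<forall>n0\<ge>1. \<exists>C>0. \<forall>n\<ge>n0 + 1. \<forall>z\<in>halfplane k.
        norm (germ_eval (L n) z) / norm (germ_eval (L n0) z) \<le> real n powr (- C * Re z))}"

definition Et_inf :: "(nat \<Rightarrow> hgerm) set" where
  "Et_inf = (\<Union>k. Et_set k)"

definition F_map :: "(nat \<Rightarrow> hgerm) \<Rightarrow> (nat \<Rightarrow> hgerm) \<Rightarrow> hgerm" where
  "F_map L \<alpha> = germ (\<lambda>z. \<Sum>n. germ_eval (\<alpha> (Suc n)) z * germ_eval (L (Suc n)) z)"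

text \<open>The series converges absolutely and locally uniformly on a right half-plane and is
  holomorphic there, so \<^const>\<open>F_map\<close> is well defined.\<close>

lemma F_map_convergence:
  assumes "\<alpha> \<in> H_inf A" "L \<in> Et_inf"
  defines "t \<equiv> \<lambda>n z. germ_eval (\<alpha> (Suc n)) z * germ_eval (L (Suc n)) z"
  shows "\<exists>k. (\<forall>z\<in>halfplane k. summable (\<lambda>n. norm (t n z))) \<and>
           (\<forall>K. compact K \<and> K \<subseteq> halfplane k \<longrightarrow>
              uniform_limit K (\<lambda>N z. \<Sum>n<N. t n z) (\<lambda>z. \<Sum>n. t n z) sequentially) \<and>
           (\<lambda>z. \<Sum>n. t n z) holomorphic_on halfplane k \<and>
           (\<forall>z\<in>halfplane k. germ_eval (F_map L \<alpha>) z = (\<Sum>n. t n z))"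
proof -
  obtain k where k: "\<alpha> \<in> H_set A k" using assms(1) by (auto simp: H_inf_def)
  obtain M :: "complex \<Rightarrow> real" where M: "continuous_on (halfplane k) M" "\<And>z. z \<in> halfplane k \<Longrightarrow> M z \<ge> 0"
    "\<And>n z. n \<ge> 1 \<Longrightarrow> z \<in> halfplane k \<Longrightarrow> norm (germ_eval (\<alpha> n) z) \<le> M z * real n powr k"
    using k by (auto simp: H_set_def)
  have \<alpha>: "\<alpha> n \<in> hol_germs k" if "n \<ge> 1" for n using k that by (auto simp: H_set_def Omega_def)
  obtain l where l: "L \<in> E_set l" using assms(2) by (auto simp: Et_inf_def Et_set_def)
  obtain c and C :: "complex \<Rightarrow> real" where c: "c > 0" and C: "continuous_on (halfplane l) C"
    "\<And>z. z \<in> halfplane l \<Longrightarrow> C z \<ge> 0"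
    "\<And>n z. n \<ge> 1 \<Longrightarrow> z \<in> halfplane l \<Longrightarrow> norm (germ_eval (L n) z) \<le> C z * real n powr (- c * Re z)"
    using l by (auto simp: E_set_def)
  have L: "L n \<in> hol_germs l" if "n \<ge> 1" for n using l that by (auto simp: E_set_def Omega_def)
  define m where "m = max (max k l) ((k + 2) / c)"
  have sub: "halfplane m \<subseteq> halfplane k" "halfplane m \<subseteq> halfplane l"
    by (auto simp: m_def halfplane_def)
  have bound: "norm (t n z) \<le> M z * C z * real (Suc n) powr (- 2)" if z: "z \<in> halfplane m" for n z
  proof -
    have zk: "z \<in> halfplane k" "z \<in> halfplane l" using z sub by auto
    have "(k + 2) / c < Re z" using z by (simp add: m_def halfplane_def)
    then have ex: "k - c * Re z \<le> - 2" using c by (simp add: field_simps)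
    have "norm (t n z) \<le> (M z * real (Suc n) powr k) * (C z * real (Suc n) powr (- c * Re z))"
      unfolding t_def norm_mult
      by (rule mult_mono) (use M(2) M(3)[of "Suc n" z] C(2) C(3)[of "Suc n" z] zk in auto)
    also have "\<dots> = M z * C z * real (Suc n) powr (k - c * Re z)"
      by (simp add: powr_diff powr_minus field_simps)
    also have "\<dots> \<le> M z * C z * real (Suc n) powr (- 2)"
      by (intro mult_left_mono powr_mono) (use ex M(2) C(2) zk in auto)
    finally show ?thesis .
  qed
  have "summable (\<lambda>n. real n powr (- 2))" by (simp add: summable_real_powr_iff)
  then have sm: "summable (\<lambda>n. real (Suc n) powr (- 2))"
    by (subst summable_Suc_iff)
  have abs: "summable (\<lambda>n. norm (t n z))" if "z \<in> halfplane m" for z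
    by (rule summable_comparison_test'[OF summable_mult[OF sm, of "M z * C z"], of 0])
      (use bound[OF that] in auto)
  have unif: "uniform_limit K (\<lambda>N z. \<Sum>n<N. t n z) (\<lambda>z. \<Sum>n. t n z) sequentially"
    if K: "compact K" "K \<subseteq> halfplane m" for K
  proof -
    have "continuous_on K (\<lambda>z. M z * C z)"
      using K(2) sub by (intro continuous_intros continuous_on_subset[OF M(1)] continuous_on_subset[OF C(1)]) auto
    then have "bounded ((\<lambda>z. M z * C z) ` K)"
      using K(1) compact_continuous_image compact_imp_bounded by blast
    then obtain B where B: "\<And>z. z \<in> K \<Longrightarrow> M z * C z \<le> B"
      unfolding bounded_iff by (auto simp: abs_le_iff)
    show ?thesis
    proof (rule Weierstrass_m_test)
      fix n z assume z: "z \<in> K"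
      show "norm (t n z) \<le> B * real (Suc n) powr (- 2)"
        by (rule order_trans[OF bound mult_right_mono]) (use z K B in auto)
    qed (intro summable_mult sm)
  qed
  have hol: "(\<lambda>z. \<Sum>n. t n z) holomorphic_on halfplane m"
  proof (rule holomorphic_uniform_sequence)
    show "(\<lambda>z. \<Sum>n<N. t n z) holomorphic_on halfplane m" for N
      unfolding t_def
      by (intro holomorphic_intros holomorphic_on_subset[OF germ_eval_holomorphic[OF \<alpha>] sub(1)]
          holomorphic_on_subset[OF germ_eval_holomorphic[OF L] sub(2)]) auto
    fix z assume "z \<in> halfplane m"
    then obtain d where "d > 0" "cball z d \<subseteq> halfplane m"
      using open_contains_cball[of "halfplane m"] by auto
    then show "\<exists>d>0. cball z d \<subseteq> halfplane m \<and>
        uniform_limit (cball z d) (\<lambda>N z. \<Sum>n<N. t n z) (\<lambda>z. \<Sum>n. t n z) sequentially"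
      using unif by (intro exI[of _ d]) auto
  qed simp
  have ev: "germ_eval (F_map L \<alpha>) z = (\<Sum>n. t n z)" if "z \<in> halfplane m" for z
    using germ_eval_germ[OF hol that] by (simp add: F_map_def t_def)
  show ?thesis using abs unif hol ev by blast
qed


section \<open>Algebraic structures\<close>

definition germ_ring :: "hgerm set \<Rightarrow> hgerm ring" where
  "germ_ring A = \<lparr>carrier = A, mult = (*), one = 1, zero = 0, add = (+)\<rparr>"

definition complex_subalgebra :: "hgerm set \<Rightarrow> bool" where
  "complex_subalgebra A \<longleftrightarrow>
     subring A (germ_ring UNIV) \<and> (\<forall>c. \<forall>f\<in>A. const_germ c * f \<in> A)"

definition O_alg :: "(hgerm, hgerm) module" where
  "O_alg = \<lparr>carrier = UNIV, mult = (*), one = 1, zero = 0, add = (+), smult = (*)\<rparr>"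

definition H_alg :: "hgerm set \<Rightarrow> (hgerm, nat \<Rightarrow> hgerm) module" where
  "H_alg A = \<lparr>carrier = H_inf A, mult = dirichlet_conv, one = (\<lambda>n. if n = 1 then 1 else 0),
     zero = (\<lambda>_. 0), add = (\<lambda>\<alpha> \<beta> n. \<alpha> n + \<beta> n), smult = (\<lambda>f \<alpha> n. f * \<alpha> n)\<rparr>"

text \<open>The qualified locale names refer to \<^theory>\<open>HOL-Algebra.Module\<close>; the unqualified ones
  are shadowed by locales of other theories.\<close>

definition module_morphism ::
  "('a, 'm) ring_scheme \<Rightarrow> ('a, 'b, 'n) module_scheme \<Rightarrow> ('a, 'c, 'p) module_scheme \<Rightarrow> ('b \<Rightarrow> 'c) \<Rightarrow> bool"
  where
  "module_morphism R M N f \<longleftrightarrow>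
     Module.module R M \<and> Module.module R N \<and> f \<in> carrier M \<rightarrow> carrier N \<and>
     (\<forall>x\<in>carrier M. \<forall>y\<in>carrier M. f (x \<oplus>\<^bsub>M\<^esub> y) = f x \<oplus>\<^bsub>N\<^esub> f y) \<and>
     (\<forall>r\<in>carrier R. \<forall>x\<in>carrier M. f (r \<odot>\<^bsub>M\<^esub> x) = r \<odot>\<^bsub>N\<^esub> f x)"

definition algebra_morphism ::
  "('a, 'm) ring_scheme \<Rightarrow> ('a, 'b, 'n) module_scheme \<Rightarrow> ('a, 'c, 'p) module_scheme \<Rightarrow> ('b \<Rightarrow> 'c) \<Rightarrow> bool"
  where
  "algebra_morphism R M N f \<longleftrightarrow>
     Module.algebra R M \<and> Module.algebra R N \<and> f \<in> ring_hom M N \<and>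
     (\<forall>r\<in>carrier R. \<forall>x\<in>carrier M. f (r \<odot>\<^bsub>M\<^esub> x) = r \<odot>\<^bsub>N\<^esub> f x)"

end

theory Submission
  imports Defs "HOL-Real_Asymp.Real_Asymp"
begin

text \<open>Two germs are equal as soon as their values agree on some right half-plane
  (\<open>germ_eqI\<close>), so each compatibility of \<open>F_map L\<close> can be checked
  pointwise at \<open>z\<close> with large real part, where the series converges absolutely.
  Additivity and \<open>A\<close>-linearity are then termwise. If \<open>L\<close> is completely
  multiplicative, the product of two such series can be regrouped along \<open>n = a * b\<close>
  (\<open>dirichlet_product_sums\<close>) and becomes the series of the Dirichlet convolution; and
  \<open>L 1\<close>, being idempotent and free of zeros, is \<open>1\<close>.

  That \<open>H_inf A\<close> is an algebra is a matter of growth: subexponential bounds on the real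
  axis survive products (\<open>tendsto_exp_decay_mult\<close>), and convolution costs at most one
  power of \<open>n\<close>, because \<open>n\<close> has at most \<open>n\<close> divisors
  (\<open>H_inf_dirichlet_conv\<close>).

  The heart is injectivity. Suppose \<open>F_map L \<alpha> = 0\<close> and let
  \<open>\<alpha> n0\<close> be the first nonzero coefficient. Solving for it at a real point
  \<open>x\<close> gives minus the sum over \<open>n > n0\<close> of
  \<open>\<alpha>(n) L(n) / L(n0)\<close>, whose terms are at most \<open>M(x) n^(k - C x)\<close>.
  All these \<open>n\<close> are at least 2, so the sum is bounded by a constant times
  \<open>M(x) 2^(- C x)\<close>. Since \<open>M\<close> grows more slowly than every exponential,
  \<open>\<alpha> n0\<close> decays exponentially, that is, it lies in \<open>I_inf\<close>
  (\<open>leading_coeff_in_I_inf\<close>). But no nonzero element of \<open>A\<close> lies in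
  \<open>I_inf\<close>. Induction on the index turns this into a trivial kernel
  (\<open>F_map_eq_0_imp\<close>), and linearity gives injectivity
  (\<open>F_map_inj_on\<close>).\<close>

section \<open>Germs\<close>

lemma hol_germs_mono: "k \<le> l \<Longrightarrow> hol_germs k \<subseteq> hol_germs l"
  unfolding hol_germs_def using halfplane_mono holomorphic_on_subset by blast

text \<open>Reduces identities of germs to identities of complex numbers. The half-plane
  \<open>m\<close> need not be related to \<open>k\<close> and \<open>l\<close>, because agreement
  on a common smaller half-plane already identifies germs.\<close>

lemma germ_eqI:
  assumes f: "f \<in> hol_germs k" and g: "g \<in> hol_germs l"
    and eq: "\<And>z. z \<in> halfplane m \<Longrightarrow> germ_eval f z = germ_eval g z"
  shows "f = g"
proof -
  define n where "n = max k (max l m)"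
  have hol: "germ_eval f holomorphic_on halfplane n" "germ_eval g holomorphic_on halfplane n"
    using f g hol_germs_mono[of k n] hol_germs_mono[of l n]
    by (auto simp: n_def le_max_iff_disj intro!: germ_eval_holomorphic)
  have "germ_rel (germ_eval f) (germ_eval g)"
    unfolding germ_rel_def using hol eq by (intro exI[of _ n]) (auto simp: n_def halfplane_def)
  then have "germ (germ_eval f) = germ (germ_eval g)"
    using germ_eq_iff hol by blast
  then show ?thesis using germ_germ_eval[OF f] germ_germ_eval[OF g] by simp
qed

lemma germ_add:
  assumes "f holomorphic_on halfplane k" "g holomorphic_on halfplane k"
  shows "germ f + germ g = germ (\<lambda>z. f z + g z)"
  using assms by (simp add: plus_hgerm.abs_eq germ_rel_refl)

lemma germ_mult:
  assumes "f holomorphic_on halfplane k" "g holomorphic_on halfplane k"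
  shows "germ f * germ g = germ (\<lambda>z. f z * g z)"
  using assms by (simp add: times_hgerm.abs_eq germ_rel_refl)

lemma add_in_hol_germs [intro]: "f \<in> hol_germs k \<Longrightarrow> g \<in> hol_germs k \<Longrightarrow> f + g \<in> hol_germs k"
  unfolding hol_germs_def using germ_add holomorphic_on_add by blast

lemma mult_in_hol_germs [intro]: "f \<in> hol_germs k \<Longrightarrow> g \<in> hol_germs k \<Longrightarrow> f * g \<in> hol_germs k"
  unfolding hol_germs_def using germ_mult holomorphic_on_mult by blast

lemma zero_in_hol_germs [intro, simp]: "0 \<in> hol_germs k"
  unfolding hol_germs_def zero_hgerm_def by auto

lemma one_in_hol_germs [intro, simp]: "1 \<in> hol_germs k"
  unfolding hol_germs_def one_hgerm_def by auto

lemma sum_in_hol_germs: "(\<And>i. i \<in> S \<Longrightarrow> f i \<in> hol_germs k) \<Longrightarrow> sum f S \<in> hol_germs k"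
  by (induction S rule: infinite_finite_induct) auto

lemma germ_eval_0 [simp]: "germ_eval 0 z = 0"
  \<comment> \<open>A constant is holomorphic everywhere, so any half-plane containing
    \<open>z\<close> will do; \<open>Re z - 1\<close> selects one.\<close>
  unfolding zero_hgerm_def by (rule germ_eval_germ[of _ "Re z - 1"]) (auto simp: halfplane_def)

lemma germ_eval_1 [simp]: "germ_eval 1 z = 1"
  unfolding one_hgerm_def by (rule germ_eval_germ[of _ "Re z - 1"]) (auto simp: halfplane_def)

lemma germ_eval_add:
  assumes "f \<in> hol_germs k" "g \<in> hol_germs k" "z \<in> halfplane k"
  shows "germ_eval (f + g) z = germ_eval f z + germ_eval g z"
proof -
  obtain f' g' where f': "f = germ f'" "f' holomorphic_on halfplane k"
    and g': "g = germ g'" "g' holomorphic_on halfplane k"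
    using assms by (auto simp: hol_germs_def)
  then show ?thesis
    using germ_eval_germ[OF holomorphic_on_add[OF f'(2) g'(2)] assms(3)] assms(3)
    by (simp add: germ_add[OF f'(2) g'(2)] germ_eval_germ)
qed

lemma germ_eval_mult:
  assumes "f \<in> hol_germs k" "g \<in> hol_germs k" "z \<in> halfplane k"
  shows "germ_eval (f * g) z = germ_eval f z * germ_eval g z"
proof -
  obtain f' g' where f': "f = germ f'" "f' holomorphic_on halfplane k"
    and g': "g = germ g'" "g' holomorphic_on halfplane k"
    using assms by (auto simp: hol_germs_def)
  then show ?thesis
    using germ_eval_germ[OF holomorphic_on_mult[OF f'(2) g'(2)] assms(3)] assms(3)
    by (simp add: germ_mult[OF f'(2) g'(2)] germ_eval_germ)
qed

lemma germ_eval_sum: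
  assumes "\<And>i. i \<in> S \<Longrightarrow> f i \<in> hol_germs k" "z \<in> halfplane k"
  shows "germ_eval (sum f S) z = (\<Sum>i\<in>S. germ_eval (f i) z)"
  using assms(1)
proof (induction S rule: infinite_finite_induct)
  case (insert i S)
  then show ?case
    using germ_eval_add[of "f i" k "sum f S" z] sum_in_hol_germs[of S f k] assms(2) by simp
qed auto

section \<open>Dirichlet convolution\<close>

text \<open>Positivity of both factors keeps the set finite and makes it empty at
  \<open>n = 0\<close>, in accordance with functions that vanish at \<open>0\<close>.\<close>

definition divisor_pairs :: "nat \<Rightarrow> (nat \<times> nat) set" where
  "divisor_pairs n = {(a, b). a \<ge> 1 \<and> b \<ge> 1 \<and> a * b = n}"

lemma divisor_pairs_iff: "(a, b) \<in> divisor_pairs n \<longleftrightarrow> a \<ge> 1 \<and> b \<ge> 1 \<and> a * b = n"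
  by (simp add: divisor_pairs_def)

lemma dirichlet_conv_altdef: "dirichlet_conv \<alpha> \<beta> n = (\<Sum>(a, b)\<in>divisor_pairs n. \<alpha> a * \<beta> b)"
  by (simp add: dirichlet_conv_def divisor_pairs_def)

lemma finite_divisor_pairs [simp]: "finite (divisor_pairs n)"
proof (rule finite_subset)
  show "divisor_pairs n \<subseteq> {..n} \<times> {..n}" by (auto simp: divisor_pairs_iff)
qed auto

text \<open>A pair is determined by its first component, which lies in \<open>{1..n}\<close>. This
  crude count suffices for the growth estimate of convolutions.\<close>

lemma card_divisor_pairs_le: "card (divisor_pairs n) \<le> n"
proof -
  have "inj_on fst (divisor_pairs n)"
    by (auto simp: inj_on_def divisor_pairs_iff)
  moreover have "fst ` divisor_pairs n \<subseteq> {1..n}" by (auto simp: divisor_pairs_iff)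
  ultimately have "card (divisor_pairs n) \<le> card {1..n}"
    by (intro card_inj_on_le) auto
  then show ?thesis by simp
qed

lemma divisor_pairs_0 [simp]: "divisor_pairs 0 = {}"
  by (auto simp: divisor_pairs_iff)

lemma dirichlet_conv_0 [simp]: "dirichlet_conv \<alpha> \<beta> 0 = 0"
  by (simp add: dirichlet_conv_altdef)

lemma dirichlet_conv_commute: "dirichlet_conv \<alpha> \<beta> = dirichlet_conv \<beta> \<alpha>"
proof
  fix n
  show "dirichlet_conv \<alpha> \<beta> n = dirichlet_conv \<beta> \<alpha> n"
    unfolding dirichlet_conv_altdef
    by (rule sum.reindex_bij_witness[of _ prod.swap prod.swap]) (auto simp: mult.commute divisor_pairs_iff)
qed

text \<open>Both sides sum over the factorisations of \<open>n\<close> into three positive factors;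
  the bijection regroups \<open>(a * b) * c\<close> as \<open>a * (b * c)\<close>.\<close>

lemma dirichlet_conv_assoc:
  "dirichlet_conv (dirichlet_conv \<alpha> \<beta>) \<gamma> = dirichlet_conv \<alpha> (dirichlet_conv \<beta> \<gamma>)"
proof
  fix n
  have "dirichlet_conv (dirichlet_conv \<alpha> \<beta>) \<gamma> n =
      (\<Sum>x\<in>divisor_pairs n. \<Sum>y\<in>divisor_pairs (fst x). \<alpha> (fst y) * \<beta> (snd y) * \<gamma> (snd x))"
    unfolding dirichlet_conv_altdef by (simp add: case_prod_beta sum_distrib_right)
  also have "\<dots> = (\<Sum>(x, y)\<in>Sigma (divisor_pairs n) (\<lambda>x. divisor_pairs (fst x)).
      \<alpha> (fst y) * \<beta> (snd y) * \<gamma> (snd x))"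
    by (rule sum.Sigma) auto
  also have "\<dots> = (\<Sum>(x, y)\<in>Sigma (divisor_pairs n) (\<lambda>x. divisor_pairs (snd x)).
      \<alpha> (fst x) * (\<beta> (fst y) * \<gamma> (snd y)))"
    by (rule sum.reindex_bij_witness[of _
          "\<lambda>((a, e), (b, c)). ((a * b, c), (a, b))" "\<lambda>((d, c), (a, b)). ((a, b * c), (b, c))"])
      (auto simp: mult.assoc divisor_pairs_iff)
  also have "\<dots> = (\<Sum>x\<in>divisor_pairs n. \<Sum>y\<in>divisor_pairs (snd x).
      \<alpha> (fst x) * (\<beta> (fst y) * \<gamma> (snd y)))"
    by (rule sum.Sigma[symmetric]) auto
  also have "\<dots> = dirichlet_conv \<alpha> (dirichlet_conv \<beta> \<gamma>) n"
    unfolding dirichlet_conv_altdef by (simp add: case_prod_beta sum_distrib_left)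
  finally show "dirichlet_conv (dirichlet_conv \<alpha> \<beta>) \<gamma> n = dirichlet_conv \<alpha> (dirichlet_conv \<beta> \<gamma>) n" .
qed

lemma dirichlet_conv_add_left:
  "dirichlet_conv (\<lambda>n. \<alpha> n + \<beta> n) \<gamma> = (\<lambda>n. dirichlet_conv \<alpha> \<gamma> n + dirichlet_conv \<beta> \<gamma> n)"
  by (auto simp: dirichlet_conv_altdef case_prod_beta distrib_right sum.distrib)

lemma dirichlet_conv_smult_left:
  "dirichlet_conv (\<lambda>n. f * \<alpha> n) \<beta> = (\<lambda>n. f * dirichlet_conv \<alpha> \<beta> n)"
  by (auto simp: dirichlet_conv_altdef case_prod_beta sum_distrib_left mult.assoc)

text \<open>Only the pair \<open>(1, n)\<close> contributes. Every convolution vanishes at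
  \<open>0\<close>, hence the condition on \<open>\<alpha> 0\<close>.\<close>

lemma dirichlet_conv_one_left:
  assumes "\<alpha> 0 = 0"
  shows "dirichlet_conv (\<lambda>n. if n = 1 then 1 else 0) \<alpha> = \<alpha>"
proof
  fix n
  show "dirichlet_conv (\<lambda>n. if n = 1 then 1 else 0) \<alpha> n = \<alpha> n"
  proof (cases "n = 0")
    case False
    have "dirichlet_conv (\<lambda>n. if n = 1 then 1 else 0) \<alpha> n = (\<Sum>(a, b)\<in>{(1::nat, n)}. \<alpha> b)"
      unfolding dirichlet_conv_altdef
      by (rule sum.mono_neutral_cong_right) (use False in \<open>auto simp: divisor_pairs_iff split: if_splits\<close>)
    then show ?thesis by simp
  qed (simp add: assms)
qed

section \<open>Products of absolutely convergent series\<close>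

text \<open>The analogue of the Cauchy product with pairs collected by their product instead of
  their sum: the double family is absolutely summable, so it may be summed in any grouping.\<close>

lemma dirichlet_product_sums:
  fixes u v :: "nat \<Rightarrow> complex"
  assumes u: "summable (\<lambda>n. norm (u n))" "u sums U" "u 0 = 0"
    and v: "summable (\<lambda>n. norm (v n))" "v sums V" "v 0 = 0"
  shows "(\<lambda>n. \<Sum>(a, b)\<in>divisor_pairs n. u a * v b) sums (U * V)"
proof -
  have uv: "(u has_sum U) UNIV" "(v has_sum V) UNIV"
    using norm_summable_imp_has_sum u v by blast+
  obtain U' V' where UV': "(\<lambda>n. norm (u n)) sums U'" "(\<lambda>n. norm (v n)) sums V'"
    using u(1) v(1) unfolding summable_def by blast
  have nuv: "((\<lambda>n. norm (u n)) has_sum U') UNIV" "((\<lambda>n. norm (v n)) has_sum V') UNIV"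
    using norm_summable_imp_has_sum[of "\<lambda>n. norm (u n)"] norm_summable_imp_has_sum[of "\<lambda>n. norm (v n)"]
      u(1) v(1) UV' by auto
  \<comment> \<open>The row of index \<open>a\<close> has absolute sum
    \<open>norm (u a) * V'\<close>, and these row sums are summable in \<open>a\<close>.\<close>
  have "(\<lambda>x. norm ((\<lambda>(a, b). u a * v b) x)) summable_on (UNIV \<times> UNIV)"
  proof (rule summable_on_SigmaI)
    fix a :: nat
    show "((\<lambda>b. norm ((\<lambda>(a, b). u a * v b) (a, b))) has_sum norm (u a) * V') UNIV"
      using has_sum_cmult_right[OF nuv(2), of "norm (u a)"] by (simp add: norm_mult)
    show "(\<lambda>a. norm (u a) * V') summable_on UNIV"
      using has_sum_cmult_left[OF nuv(1)] has_sum_imp_summable by blast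
  qed auto
  then have "(\<lambda>(a, b). u a * v b) summable_on (UNIV \<times> UNIV)"
    by (rule abs_summable_summable)
  then have "((\<lambda>(a, b). u a * v b) has_sum U * V) (UNIV \<times> UNIV)"
    using has_sum_cmult_right[OF uv(2)] has_sum_cmult_left[OF uv(1)]
    by (intro has_sum_SigmaI[where g = "\<lambda>a. u a * V"]) auto
  \<comment> \<open>Pairs with a zero component contribute nothing since
    \<open>u 0 = v 0 = 0\<close>; the remaining positive pairs are partitioned into the finite
    fibres \<open>divisor_pairs n\<close> of multiplication.\<close>
  also have "?this \<longleftrightarrow> ((\<lambda>(a, b). u a * v b) has_sum U * V) ({1..} \<times> {1..})"
    by (rule has_sum_cong_neutral) (use u(3) v(3) in \<open>auto simp: Suc_le_eq intro!: gr0I\<close>)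
  also have "\<dots> \<longleftrightarrow> ((\<lambda>(n, a, b). u a * v b) has_sum U * V) (SIGMA n:UNIV. divisor_pairs n)"
    by (rule has_sum_reindex_bij_witness[of _ snd "\<lambda>(a, b). (a * b, a, b)"])
      (auto simp: divisor_pairs_iff)
  finally have "((\<lambda>n. \<Sum>(a, b)\<in>divisor_pairs n. u a * v b) has_sum U * V) UNIV"
    by (rule has_sum_SigmaD) (auto intro!: has_sum_finiteI simp: case_prod_beta)
  then show ?thesis by (rule has_sum_imp_sums)
qed

section \<open>The algebra of coefficient functions\<close>

text \<open>Each factor absorbs half of the exponent \<open>a\<close>, which is possible because the
  hypotheses hold for every positive rate.\<close>

lemma tendsto_exp_decay_mult:
  fixes f g :: "real \<Rightarrow> real"
  assumes "\<forall>a>0. ((\<lambda>x. exp (- a * x) * f x) \<longlongrightarrow> 0) at_top"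
    and "\<forall>a>0. ((\<lambda>x. exp (- a * x) * g x) \<longlongrightarrow> 0) at_top" and "a > 0"
  shows "((\<lambda>x. exp (- a * x) * (f x * g x)) \<longlongrightarrow> 0) at_top"
proof -
  have "((\<lambda>x. (exp (- (a / 2) * x) * f x) * (exp (- (a / 2) * x) * g x)) \<longlongrightarrow> 0 * 0) at_top"
    using assms(3) by (intro tendsto_mult assms(1,2)[rule_format]) auto
  moreover have "exp (- a * x) = exp (- (a / 2) * x) * exp (- (a / 2) * x)" for x
    by (simp flip: exp_add)
  ultimately show ?thesis by (simp add: mult_ac)
qed

lemma H_setE:
  assumes "\<alpha> \<in> H_set A k"
  obtains M :: "complex \<Rightarrow> real" where "continuous_on (halfplane k) M"
    "\<And>z. z \<in> halfplane k \<Longrightarrow> M z \<ge> 0"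
    "\<And>n z. n \<ge> 1 \<Longrightarrow> z \<in> halfplane k \<Longrightarrow> norm (germ_eval (\<alpha> n) z) \<le> M z * real n powr k"
    "\<forall>a>0. ((\<lambda>x. exp (- a * x) * M (complex_of_real x)) \<longlongrightarrow> 0) at_top"
  using assms by (auto simp: H_set_def)

lemma H_set_coeff:
  assumes "\<alpha> \<in> H_set A k"
  shows "\<alpha> 0 = 0" "n \<ge> 1 \<Longrightarrow> \<alpha> n \<in> A" "\<alpha> n \<in> hol_germs k"
proof -
  show 0: "\<alpha> 0 = 0" and "n \<ge> 1 \<Longrightarrow> \<alpha> n \<in> A"
    using assms by (auto simp: H_set_def Omega_def)
  show "\<alpha> n \<in> hol_germs k"
    using assms 0 by (cases "n = 0") (auto simp: H_set_def Omega_def)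
qed

text \<open>The same \<open>M\<close> serves, since \<open>n \<ge> 1\<close> makes the power of
  \<open>n\<close> increase with the exponent. Thus finitely many elements of \<open>H_inf A\<close>
  share one \<open>k\<close>.\<close>

lemma H_set_mono:
  assumes "k \<le> l"
  shows "H_set A k \<subseteq> H_set A l"
proof
  fix \<alpha> assume \<alpha>: "\<alpha> \<in> H_set A k"
  obtain M where M: "continuous_on (halfplane k) M" "\<And>z. z \<in> halfplane k \<Longrightarrow> M z \<ge> 0"
    "\<And>n z. n \<ge> 1 \<Longrightarrow> z \<in> halfplane k \<Longrightarrow> norm (germ_eval (\<alpha> n) z) \<le> M z * real n powr k"
    "\<forall>a>0. ((\<lambda>x. exp (- a * x) * M (complex_of_real x)) \<longlongrightarrow> 0) at_top"
    using H_setE[OF \<alpha>] by blast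
  have sub: "z \<in> halfplane k" if "z \<in> halfplane l" for z
    using halfplane_mono[OF assms] that by blast
  have "norm (germ_eval (\<alpha> n) z) \<le> M z * real n powr l" if "n \<ge> 1" "z \<in> halfplane l" for n z
  proof -
    have "norm (germ_eval (\<alpha> n) z) \<le> M z * real n powr k" using M(3) sub that by auto
    also have "\<dots> \<le> M z * real n powr l"
      using assms that M(2) sub by (intro mult_left_mono powr_mono) auto
    finally show ?thesis .
  qed
  then show "\<alpha> \<in> H_set A l"
    using M H_set_coeff[OF \<alpha>] sub hol_germs_mono[OF assms] continuous_on_subset[OF M(1) halfplane_mono[OF assms]]
    unfolding H_set_def Omega_def by blast
qed

lemma H_inf_common:
  assumes "\<alpha> \<in> H_inf A" "\<beta> \<in> H_inf A"
  obtains k where "\<alpha> \<in> H_set A k" "\<beta> \<in> H_set A k"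
proof -
  obtain k l where "\<alpha> \<in> H_set A k" "\<beta> \<in> H_set A l" using assms by (auto simp: H_inf_def)
  then show ?thesis
    using H_set_mono[of k "max k l" A] H_set_mono[of l "max k l" A] that[of "max k l"] by auto
qed

section \<open>Closure of \<open>H_inf A\<close> under the algebra operations\<close>

lemma complex_subalgebraD:
  assumes "complex_subalgebra A"
  shows "0 \<in> A" "1 \<in> A" "f \<in> A \<Longrightarrow> g \<in> A \<Longrightarrow> f + g \<in> A" "f \<in> A \<Longrightarrow> g \<in> A \<Longrightarrow> f * g \<in> A"
    "f \<in> A \<Longrightarrow> - f \<in> A"
proof -
  have sub: "subring A (germ_ring UNIV)" using assms by (simp add: complex_subalgebra_def)
  note E = subringE[OF sub]
  show "0 \<in> A" "1 \<in> A" "f \<in> A \<Longrightarrow> g \<in> A \<Longrightarrow> f + g \<in> A" "f \<in> A \<Longrightarrow> g \<in> A \<Longrightarrow> f * g \<in> A"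
    using E(2,3,6,7) by (simp_all add: germ_ring_def)
  \<comment> \<open>Negation is scalar multiplication by the constant \<open>-1\<close>, so the
    abstract additive inverse of \<open>germ_ring UNIV\<close> never has to be computed.\<close>
  have "const_germ (- 1) = - 1"
    by transfer (auto simp: germ_rel_def)
  then show "f \<in> A \<Longrightarrow> - f \<in> A"
    using assms unfolding complex_subalgebra_def by (metis mult_minus1)
qed

lemma complex_subalgebra_sum:
  assumes "complex_subalgebra A" "\<And>i. i \<in> S \<Longrightarrow> f i \<in> A"
  shows "sum f S \<in> A"
  using assms(2)
  by (induction S rule: infinite_finite_induct) (auto intro: complex_subalgebraD[OF assms(1)])

lemma H_inf_zero:
  assumes "complex_subalgebra A"
  shows "(\<lambda>_. 0) \<in> H_inf A"
proof -
  have "(\<lambda>_. 0) \<in> H_set A 0"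
    using complex_subalgebraD(1)[OF assms]
    by (auto simp: H_set_def Omega_def intro!: exI[of _ "\<lambda>_. 0"])
  then show ?thesis by (auto simp: H_inf_def)
qed

lemma H_inf_one:
  assumes "complex_subalgebra A"
  shows "(\<lambda>n. if n = 1 then 1 else 0) \<in> H_inf A"
proof -
  have "((\<lambda>x. exp (- a * x)) \<longlongrightarrow> 0) at_top" if "a > 0" for a :: real
    using that by real_asymp
  then have "(\<lambda>n. if n = 1 then 1 else 0) \<in> H_set A 0"
    using complex_subalgebraD(1,2)[OF assms]
    by (auto simp: H_set_def Omega_def intro!: exI[of _ "\<lambda>_. 1"])
  then show ?thesis by (auto simp: H_inf_def)
qed

lemma H_inf_add:
  assumes A: "complex_subalgebra A" and "\<alpha> \<in> H_inf A" "\<beta> \<in> H_inf A"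
  shows "(\<lambda>n. \<alpha> n + \<beta> n) \<in> H_inf A"
proof -
  obtain k where k: "\<alpha> \<in> H_set A k" "\<beta> \<in> H_set A k"
    using H_inf_common[OF assms(2,3)] by blast
  obtain M where M: "continuous_on (halfplane k) M" "\<And>z. z \<in> halfplane k \<Longrightarrow> M z \<ge> 0"
    "\<And>n z. n \<ge> 1 \<Longrightarrow> z \<in> halfplane k \<Longrightarrow> norm (germ_eval (\<alpha> n) z) \<le> M z * real n powr k"
    "\<forall>a>0. ((\<lambda>x. exp (- a * x) * M (complex_of_real x)) \<longlongrightarrow> 0) at_top"
    using H_setE[OF k(1)] by blast
  obtain N where N: "continuous_on (halfplane k) N" "\<And>z. z \<in> halfplane k \<Longrightarrow> N z \<ge> 0"
    "\<And>n z. n \<ge> 1 \<Longrightarrow> z \<in> halfplane k \<Longrightarrow> norm (germ_eval (\<beta> n) z) \<le> N z * real n powr k"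
    "\<forall>a>0. ((\<lambda>x. exp (- a * x) * N (complex_of_real x)) \<longlongrightarrow> 0) at_top"
    using H_setE[OF k(2)] by blast
  note c = H_set_coeff[OF k(1)] H_set_coeff[OF k(2)]
  have "norm (germ_eval (\<alpha> n + \<beta> n) z) \<le> (M z + N z) * real n powr k"
    if "n \<ge> 1" "z \<in> halfplane k" for n z
    using norm_triangle_ineq[of "germ_eval (\<alpha> n) z" "germ_eval (\<beta> n) z"] M(3)[OF that] N(3)[OF that]
    by (simp add: germ_eval_add[OF c(3) c(6) that(2)] distrib_right)
  moreover have "((\<lambda>x. exp (- a * x) * (M (complex_of_real x) + N (complex_of_real x))) \<longlongrightarrow> 0) at_top"
    if "a > 0" for a
    using tendsto_add[OF M(4)[rule_format, OF that] N(4)[rule_format, OF that]]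
    by (simp add: distrib_left)
  moreover have "continuous_on (halfplane k) (\<lambda>z. M z + N z)"
    using M(1) N(1) by (intro continuous_intros)
  ultimately have "(\<lambda>n. \<alpha> n + \<beta> n) \<in> H_set A k"
    using c complex_subalgebraD(3)[OF A] M(2) N(2) unfolding H_set_def Omega_def
    by (auto intro!: exI[of _ "\<lambda>z. M z + N z"])
  then show ?thesis by (auto simp: H_inf_def)
qed

text \<open>The bound for \<open>\<alpha>\<close> gets multiplied by the modulus of
  \<open>f\<close>, and \<open>A \<subseteq> B_inf\<close> says precisely that this modulus is
  subexponential on the real axis.\<close>

lemma H_inf_smult:
  assumes A: "complex_subalgebra A" "A \<subseteq> B_inf" and f: "f \<in> A" and "\<alpha> \<in> H_inf A"
  shows "(\<lambda>n. f * \<alpha> n) \<in> H_inf A"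
proof -
  obtain l where l: "f \<in> B_germs l" using A f by (auto simp: B_inf_def)
  obtain k' where k': "\<alpha> \<in> H_set A k'" using assms(4) by (auto simp: H_inf_def)
  define k where "k = max l k'"
  have k: "\<alpha> \<in> H_set A k" using H_set_mono[of k' k A] k' by (auto simp: k_def)
  have fk: "f \<in> hol_germs k" using l hol_germs_mono[of l k] by (auto simp: k_def B_germs_def)
  have fB: "\<forall>a>0. ((\<lambda>x. exp (- a * x) * norm (germ_eval f (complex_of_real x))) \<longlongrightarrow> 0) at_top"
    using l by (simp add: B_germs_def)
  obtain M where M: "continuous_on (halfplane k) M" "\<And>z. z \<in> halfplane k \<Longrightarrow> M z \<ge> 0"
    "\<And>n z. n \<ge> 1 \<Longrightarrow> z \<in> halfplane k \<Longrightarrow> norm (germ_eval (\<alpha> n) z) \<le> M z * real n powr k"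
    "\<forall>a>0. ((\<lambda>x. exp (- a * x) * M (complex_of_real x)) \<longlongrightarrow> 0) at_top"
    using H_setE[OF k] by blast
  note c = H_set_coeff[OF k]
  have "norm (germ_eval (f * \<alpha> n) z) \<le> norm (germ_eval f z) * M z * real n powr k"
    if "n \<ge> 1" "z \<in> halfplane k" for n z
    using mult_left_mono[OF M(3)[OF that], of "norm (germ_eval f z)"]
    by (simp add: germ_eval_mult[OF fk c(3) that(2)] norm_mult mult.assoc)
  moreover have "\<forall>a>0. ((\<lambda>x. exp (- a * x) * (norm (germ_eval f (complex_of_real x)) * M (complex_of_real x))) \<longlongrightarrow> 0) at_top"
    using tendsto_exp_decay_mult[OF fB M(4)] by blast
  moreover have "continuous_on (halfplane k) (\<lambda>z. norm (germ_eval f z) * M z)"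
    using M(1) holomorphic_on_imp_continuous_on[OF germ_eval_holomorphic[OF fk]]
    by (intro continuous_intros)
  ultimately have "(\<lambda>n. f * \<alpha> n) \<in> H_set A k"
    using c fk f complex_subalgebraD(4)[OF A(1)] M(2) unfolding H_set_def Omega_def
    by (auto intro!: exI[of _ "\<lambda>z. norm (germ_eval f z) * M z"])
  then show ?thesis by (auto simp: H_inf_def)
qed

text \<open>Each product \<open>\<alpha> a * \<beta> b\<close> with \<open>a * b = n\<close> is
  bounded by \<open>M N n^k\<close>, and there are at most \<open>n\<close> of them. The exponent
  \<open>k + 1\<close> forces the passage to the half-plane of \<open>k + 1\<close>, as one
  parameter governs both.\<close>

lemma H_inf_dirichlet_conv:
  assumes A: "complex_subalgebra A" and "\<alpha> \<in> H_inf A" "\<beta> \<in> H_inf A"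
  shows "dirichlet_conv \<alpha> \<beta> \<in> H_inf A"
proof -
  obtain k where k: "\<alpha> \<in> H_set A k" "\<beta> \<in> H_set A k"
    using H_inf_common[OF assms(2,3)] by blast
  obtain M where M: "continuous_on (halfplane k) M" "\<And>z. z \<in> halfplane k \<Longrightarrow> M z \<ge> 0"
    "\<And>n z. n \<ge> 1 \<Longrightarrow> z \<in> halfplane k \<Longrightarrow> norm (germ_eval (\<alpha> n) z) \<le> M z * real n powr k"
    "\<forall>a>0. ((\<lambda>x. exp (- a * x) * M (complex_of_real x)) \<longlongrightarrow> 0) at_top"
    using H_setE[OF k(1)] by blast
  obtain N where N: "continuous_on (halfplane k) N" "\<And>z. z \<in> halfplane k \<Longrightarrow> N z \<ge> 0"
    "\<And>n z. n \<ge> 1 \<Longrightarrow> z \<in> halfplane k \<Longrightarrow> norm (germ_eval (\<beta> n) z) \<le> N z * real n powr k"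
    "\<forall>a>0. ((\<lambda>x. exp (- a * x) * N (complex_of_real x)) \<longlongrightarrow> 0) at_top"
    using H_setE[OF k(2)] by blast
  note c = H_set_coeff[OF k(1)] H_set_coeff[OF k(2)]
  have sub: "z \<in> halfplane k" if "z \<in> halfplane (k + 1)" for z
    using that by (simp add: halfplane_def)
  have cA: "dirichlet_conv \<alpha> \<beta> n \<in> A" for n
    unfolding dirichlet_conv_altdef
    by (intro complex_subalgebra_sum[OF A])
      (auto simp: divisor_pairs_iff intro!: complex_subalgebraD(4)[OF A] c)
  have ch: "dirichlet_conv \<alpha> \<beta> n \<in> hol_germs k" for n
    unfolding dirichlet_conv_altdef by (intro sum_in_hol_germs) (auto intro: c)
  have "norm (germ_eval (dirichlet_conv \<alpha> \<beta> n) z) \<le> M z * N z * real n powr (k + 1)"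
    if n: "n \<ge> 1" and z: "z \<in> halfplane (k + 1)" for n z
  proof -
    note zk = sub[OF z]
    have "germ_eval (dirichlet_conv \<alpha> \<beta> n) z = (\<Sum>x\<in>divisor_pairs n. germ_eval (case x of (a, b) \<Rightarrow> \<alpha> a * \<beta> b) z)"
      unfolding dirichlet_conv_altdef by (rule germ_eval_sum[OF _ zk]) (auto intro: c)
    also have "norm \<dots> \<le> (\<Sum>x\<in>divisor_pairs n. M z * N z * real n powr k)"
    proof (rule sum_norm_le)
      fix x assume "x \<in> divisor_pairs n"
      then obtain a b where x: "x = (a, b)" and ab: "a \<ge> 1" "b \<ge> 1" "n = a * b"
        by (cases x) (auto simp: divisor_pairs_iff)
      have "norm (germ_eval (\<alpha> a * \<beta> b) z) \<le> (M z * real a powr k) * (N z * real b powr k)"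
        unfolding germ_eval_mult[OF c(3) c(6) zk] norm_mult
        using M(2,3) N(2,3) ab zk by (intro mult_mono) auto
      also have "\<dots> = M z * N z * real n powr k"
        by (simp add: ab powr_mult)
      finally show "norm (germ_eval (case x of (a, b) \<Rightarrow> \<alpha> a * \<beta> b) z) \<le> M z * N z * real n powr k"
        by (simp add: x)
    qed
    also have "\<dots> = real (card (divisor_pairs n)) * (M z * N z * real n powr k)" by simp
    also have "\<dots> \<le> real n * (M z * N z * real n powr k)"
      using card_divisor_pairs_le[of n] M(2)[OF zk] N(2)[OF zk] by (intro mult_right_mono) auto
    also have "\<dots> = M z * N z * real n powr (k + 1)"
      using n by (simp add: powr_add)
    finally show ?thesis .
  qed
  moreover have "\<forall>a>0. ((\<lambda>x. exp (- a * x) * (M (complex_of_real x) * N (complex_of_real x))) \<longlongrightarrow> 0) at_top"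
    using tendsto_exp_decay_mult[OF M(4) N(4)] by blast
  moreover have "continuous_on (halfplane (k + 1)) (\<lambda>z. M z * N z)"
    using M(1) N(1) sub by (intro continuous_intros) (auto elim!: continuous_on_subset)
  ultimately have "dirichlet_conv \<alpha> \<beta> \<in> H_set A (k + 1)"
    using cA ch hol_germs_mono[of k "k + 1"] M(2) N(2) sub unfolding H_set_def Omega_def
    by (auto intro!: exI[of _ "\<lambda>z. M z * N z"])
  then show ?thesis by (auto simp: H_inf_def)
qed

section \<open>The map \<open>F_L\<close>\<close>

lemma Et_infE:
  assumes "L \<in> Et_inf"
  obtains k where "\<And>n. L n \<in> hol_germs k" "\<And>n z. n \<ge> 1 \<Longrightarrow> z \<in> halfplane k \<Longrightarrow> germ_eval (L n) z \<noteq> 0"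
    "\<And>n0. n0 \<ge> 1 \<Longrightarrow> \<exists>C>0. \<forall>n\<ge>n0 + 1. \<forall>z\<in>halfplane k.
        norm (germ_eval (L n) z) / norm (germ_eval (L n0) z) \<le> real n powr (- C * Re z)"
proof -
  obtain k where k: "L \<in> Et_set k" using assms by (auto simp: Et_inf_def)
  have "L n \<in> hol_germs k" for n
    using k by (cases "n = 0") (auto simp: Et_set_def E_set_def Omega_def)
  then show ?thesis using k that[of k] by (auto simp: Et_set_def)
qed

text \<open>The convergence statement in the form used for calculations: the sum runs over all
  \<open>n\<close>, and it holds for every \<open>k'\<close> beyond some \<open>k\<close>, so that
  several series can be treated on a common half-plane.\<close>

lemma F_map_sums:
  assumes "\<alpha> \<in> H_inf A" "L \<in> Et_inf"
  shows "\<exists>k. \<forall>k'\<ge>k. F_map L \<alpha> \<in> hol_germs k' \<and> (\<forall>z\<in>halfplane k'.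
     summable (\<lambda>n. norm (germ_eval (\<alpha> n) z * germ_eval (L n) z)) \<and>
     (\<lambda>n. germ_eval (\<alpha> n) z * germ_eval (L n) z) sums germ_eval (F_map L \<alpha>) z)"
proof -
  define t where "t = (\<lambda>n z. germ_eval (\<alpha> n) z * germ_eval (L n) z)"
  have "\<exists>k. (\<forall>z\<in>halfplane k. summable (\<lambda>n. norm (t (Suc n) z))) \<and>
      (\<lambda>z. \<Sum>n. t (Suc n) z) holomorphic_on halfplane k \<and>
      (\<forall>z\<in>halfplane k. germ_eval (F_map L \<alpha>) z = (\<Sum>n. t (Suc n) z))"
    unfolding t_def by (rule ex_forward[OF F_map_convergence[OF assms]]) (elim conjE, intro conjI)
  then obtain k where k: "\<And>z. z \<in> halfplane k \<Longrightarrow> summable (\<lambda>n. norm (t (Suc n) z))"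
    "(\<lambda>z. \<Sum>n. t (Suc n) z) holomorphic_on halfplane k"
    "\<And>z. z \<in> halfplane k \<Longrightarrow> germ_eval (F_map L \<alpha>) z = (\<Sum>n. t (Suc n) z)"
    by metis
  \<comment> \<open>The series defining \<open>F_map\<close> starts at \<open>n = 1\<close>; the
    extra term at \<open>0\<close> vanishes because \<open>\<alpha> 0 = 0\<close>.\<close>
  have t0: "t 0 z = 0" for z
    using assms(1) by (auto simp: t_def H_inf_def H_set_coeff(1))
  have "F_map L \<alpha> \<in> hol_germs k"
    using k(2) unfolding F_map_def t_def hol_germs_def by blast
  moreover have "summable (\<lambda>n. norm (t n z)) \<and> (\<lambda>n. t n z) sums germ_eval (F_map L \<alpha>) z"
    if z: "z \<in> halfplane k" for z
  proof
    show "summable (\<lambda>n. norm (t n z))" using k(1)[OF z] summable_Suc_iff by blast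
    have "(\<lambda>n. t (Suc n) z) sums germ_eval (F_map L \<alpha>) z"
      using summable_norm_cancel[OF k(1)[OF z]] k(3)[OF z] by (simp add: summable_sums)
    then show "(\<lambda>n. t n z) sums germ_eval (F_map L \<alpha>) z"
      using sums_Suc[of "\<lambda>n. t n z"] t0 by simp
  qed
  ultimately show ?thesis
    unfolding t_def by (intro exI[of _ k]) (meson hol_germs_mono halfplane_mono subsetD)
qed

section \<open>Compatibility of \<open>F_map L\<close> with the operations\<close>

lemma F_map_add:
  assumes A: "complex_subalgebra A" and L: "L \<in> Et_inf" and \<alpha>: "\<alpha> \<in> H_inf A" and \<beta>: "\<beta> \<in> H_inf A"
  shows "F_map L (\<lambda>n. \<alpha> n + \<beta> n) = F_map L \<alpha> + F_map L \<beta>"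
proof -
  obtain k0 where k0: "\<alpha> \<in> H_set A k0" "\<beta> \<in> H_set A k0" using H_inf_common[OF \<alpha> \<beta>] by blast
  obtain k1 k2 k3 where
    k1: "\<forall>k\<ge>k1. F_map L \<alpha> \<in> hol_germs k \<and> (\<forall>z\<in>halfplane k.
      summable (\<lambda>n. norm (germ_eval (\<alpha> n) z * germ_eval (L n) z)) \<and>
      (\<lambda>n. germ_eval (\<alpha> n) z * germ_eval (L n) z) sums germ_eval (F_map L \<alpha>) z)" and
    k2: "\<forall>k\<ge>k2. F_map L \<beta> \<in> hol_germs k \<and> (\<forall>z\<in>halfplane k.
      summable (\<lambda>n. norm (germ_eval (\<beta> n) z * germ_eval (L n) z)) \<and>
      (\<lambda>n. germ_eval (\<beta> n) z * germ_eval (L n) z) sums germ_eval (F_map L \<beta>) z)" and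
    k3: "\<forall>k\<ge>k3. F_map L (\<lambda>n. \<alpha> n + \<beta> n) \<in> hol_germs k \<and> (\<forall>z\<in>halfplane k.
      summable (\<lambda>n. norm (germ_eval (\<alpha> n + \<beta> n) z * germ_eval (L n) z)) \<and>
      (\<lambda>n. germ_eval (\<alpha> n + \<beta> n) z * germ_eval (L n) z) sums germ_eval (F_map L (\<lambda>n. \<alpha> n + \<beta> n)) z)"
    using F_map_sums[OF \<alpha> L] F_map_sums[OF \<beta> L] F_map_sums[OF H_inf_add[OF A \<alpha> \<beta>] L] by auto
  \<comment> \<open>On this half-plane all three series converge and all coefficients of
    \<open>\<alpha>\<close> and \<open>\<beta>\<close> can be evaluated, so uniqueness of sums
    compares the two sides.\<close>
  define k where "k = Max {k0, k1, k2, k3}"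
  have k: "k \<ge> k0" "k \<ge> k1" "k \<ge> k2" "k \<ge> k3" by (auto simp: k_def)
  note hol = k1[rule_format, OF k(2), THEN conjunct1] k2[rule_format, OF k(3), THEN conjunct1]
    k3[rule_format, OF k(4), THEN conjunct1]
  have c: "\<alpha> n \<in> hol_germs k" "\<beta> n \<in> hol_germs k" for n
    using H_set_coeff(3) H_set_mono[OF k(1)] k0 by blast+
  show ?thesis
  proof (rule germ_eqI)
    show "F_map L (\<lambda>n. \<alpha> n + \<beta> n) \<in> hol_germs k" "F_map L \<alpha> + F_map L \<beta> \<in> hol_germs k"
      using hol by auto
    fix z assume z: "z \<in> halfplane k"
    have "(\<lambda>n. germ_eval (\<alpha> n) z * germ_eval (L n) z + germ_eval (\<beta> n) z * germ_eval (L n) z)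
        sums (germ_eval (F_map L \<alpha>) z + germ_eval (F_map L \<beta>) z)"
      using k1 k2 k z by (intro sums_add) auto
    then have "(\<lambda>n. germ_eval (\<alpha> n + \<beta> n) z * germ_eval (L n) z)
        sums germ_eval (F_map L \<alpha> + F_map L \<beta>) z"
      by (simp add: germ_eval_add[OF c z] germ_eval_add[OF hol(1,2) z] distrib_right)
    then show "germ_eval (F_map L (\<lambda>n. \<alpha> n + \<beta> n)) z = germ_eval (F_map L \<alpha> + F_map L \<beta>) z"
      using k3 k(4) z sums_unique2 by blast
  qed
qed

lemma F_map_smult:
  assumes A: "complex_subalgebra A" "A \<subseteq> B_inf" and L: "L \<in> Et_inf" and f: "f \<in> A"
    and \<alpha>: "\<alpha> \<in> H_inf A"
  shows "F_map L (\<lambda>n. f * \<alpha> n) = f * F_map L \<alpha>"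
proof -
  obtain k0 where k0: "\<alpha> \<in> H_set A k0" using \<alpha> by (auto simp: H_inf_def)
  obtain l where l: "f \<in> hol_germs l" using f A by (auto simp: B_inf_def B_germs_def)
  obtain k1 k2 where
    k1: "\<forall>k\<ge>k1. F_map L \<alpha> \<in> hol_germs k \<and> (\<forall>z\<in>halfplane k.
      summable (\<lambda>n. norm (germ_eval (\<alpha> n) z * germ_eval (L n) z)) \<and>
      (\<lambda>n. germ_eval (\<alpha> n) z * germ_eval (L n) z) sums germ_eval (F_map L \<alpha>) z)" and
    k2: "\<forall>k\<ge>k2. F_map L (\<lambda>n. f * \<alpha> n) \<in> hol_germs k \<and> (\<forall>z\<in>halfplane k.
      summable (\<lambda>n. norm (germ_eval (f * \<alpha> n) z * germ_eval (L n) z)) \<and>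
      (\<lambda>n. germ_eval (f * \<alpha> n) z * germ_eval (L n) z) sums germ_eval (F_map L (\<lambda>n. f * \<alpha> n)) z)"
    using F_map_sums[OF \<alpha> L] F_map_sums[OF H_inf_smult[OF A f \<alpha>] L] by auto
  define k where "k = Max {k0, k1, k2, l}"
  have k: "k \<ge> k0" "k \<ge> k1" "k \<ge> k2" "k \<ge> l" by (auto simp: k_def)
  note hol = k1[rule_format, OF k(2), THEN conjunct1] k2[rule_format, OF k(3), THEN conjunct1]
  have c: "f \<in> hol_germs k" "\<alpha> n \<in> hol_germs k" for n
    using H_set_coeff(3) H_set_mono[OF k(1)] k0 l hol_germs_mono[OF k(4)] by blast+
  show ?thesis
  proof (rule germ_eqI)
    show "F_map L (\<lambda>n. f * \<alpha> n) \<in> hol_germs k" "f * F_map L \<alpha> \<in> hol_germs k"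
      using hol c by auto
    fix z assume z: "z \<in> halfplane k"
    have "(\<lambda>n. germ_eval f z * (germ_eval (\<alpha> n) z * germ_eval (L n) z))
        sums (germ_eval f z * germ_eval (F_map L \<alpha>) z)"
      using k1 k z by (intro sums_mult) auto
    then have "(\<lambda>n. germ_eval (f * \<alpha> n) z * germ_eval (L n) z) sums germ_eval (f * F_map L \<alpha>) z"
      by (simp add: germ_eval_mult[OF c z] germ_eval_mult[OF c(1) hol(1) z] mult.assoc)
    then show "germ_eval (F_map L (\<lambda>n. f * \<alpha> n)) z = germ_eval (f * F_map L \<alpha>) z"
      using k2 k(3) z sums_unique2 by blast
  qed
qed

text \<open>For \<open>a * b = n\<close> the factor \<open>L n\<close> splits as
  \<open>L a * L b\<close>, so the \<open>n\<close>-th term on the left collects the products of the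
  \<open>a\<close>-th and \<open>b\<close>-th terms of the two series on the right.\<close>

lemma F_map_dirichlet_conv:
  assumes A: "complex_subalgebra A" and L: "L \<in> Et_inf"
    and mult: "\<forall>a\<ge>1. \<forall>b\<ge>1. L (a * b) = L a * L b"
    and \<alpha>: "\<alpha> \<in> H_inf A" and \<beta>: "\<beta> \<in> H_inf A"
  shows "F_map L (dirichlet_conv \<alpha> \<beta>) = F_map L \<alpha> * F_map L \<beta>"
proof -
  obtain k0 where k0: "\<alpha> \<in> H_set A k0" "\<beta> \<in> H_set A k0" using H_inf_common[OF \<alpha> \<beta>] by blast
  obtain l where l: "\<And>n. L n \<in> hol_germs l" using Et_infE[OF L] by metis
  obtain k1 k2 k3 where
    k1: "\<forall>k\<ge>k1. F_map L \<alpha> \<in> hol_germs k \<and> (\<forall>z\<in>halfplane k.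
      summable (\<lambda>n. norm (germ_eval (\<alpha> n) z * germ_eval (L n) z)) \<and>
      (\<lambda>n. germ_eval (\<alpha> n) z * germ_eval (L n) z) sums germ_eval (F_map L \<alpha>) z)" and
    k2: "\<forall>k\<ge>k2. F_map L \<beta> \<in> hol_germs k \<and> (\<forall>z\<in>halfplane k.
      summable (\<lambda>n. norm (germ_eval (\<beta> n) z * germ_eval (L n) z)) \<and>
      (\<lambda>n. germ_eval (\<beta> n) z * germ_eval (L n) z) sums germ_eval (F_map L \<beta>) z)" and
    k3: "\<forall>k\<ge>k3. F_map L (dirichlet_conv \<alpha> \<beta>) \<in> hol_germs k \<and> (\<forall>z\<in>halfplane k.
      summable (\<lambda>n. norm (germ_eval (dirichlet_conv \<alpha> \<beta> n) z * germ_eval (L n) z)) \<and>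
      (\<lambda>n. germ_eval (dirichlet_conv \<alpha> \<beta> n) z * germ_eval (L n) z)
        sums germ_eval (F_map L (dirichlet_conv \<alpha> \<beta>)) z)"
    using F_map_sums[OF \<alpha> L] F_map_sums[OF \<beta> L] F_map_sums[OF H_inf_dirichlet_conv[OF A \<alpha> \<beta>] L]
    by auto
  define k where "k = Max {k0, k1, k2, k3, l}"
  have k: "k \<ge> k0" "k \<ge> k1" "k \<ge> k2" "k \<ge> k3" "k \<ge> l" by (auto simp: k_def)
  note hol = k1[rule_format, OF k(2), THEN conjunct1] k2[rule_format, OF k(3), THEN conjunct1]
    k3[rule_format, OF k(4), THEN conjunct1]
  have c: "\<alpha> n \<in> hol_germs k" "\<beta> n \<in> hol_germs k" "L n \<in> hol_germs k" for n
    using H_set_coeff(3) H_set_mono[OF k(1)] k0 l hol_germs_mono[OF k(5)] by blast+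
  show ?thesis
  proof (rule germ_eqI)
    show "F_map L (dirichlet_conv \<alpha> \<beta>) \<in> hol_germs k" "F_map L \<alpha> * F_map L \<beta> \<in> hol_germs k"
      using hol by auto
    fix z assume z: "z \<in> halfplane k"
    have "germ_eval (dirichlet_conv \<alpha> \<beta> n) z * germ_eval (L n) z =
        (\<Sum>(a, b)\<in>divisor_pairs n. (germ_eval (\<alpha> a) z * germ_eval (L a) z) *
          (germ_eval (\<beta> b) z * germ_eval (L b) z))" for n
    proof -
      have "germ_eval (dirichlet_conv \<alpha> \<beta> n) z =
          (\<Sum>x\<in>divisor_pairs n. germ_eval (case x of (a, b) \<Rightarrow> \<alpha> a * \<beta> b) z)"
        unfolding dirichlet_conv_altdef by (rule germ_eval_sum[OF _ z]) (auto intro: c)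
      then have "germ_eval (dirichlet_conv \<alpha> \<beta> n) z * germ_eval (L n) z =
          (\<Sum>x\<in>divisor_pairs n. germ_eval (case x of (a, b) \<Rightarrow> \<alpha> a * \<beta> b) z * germ_eval (L n) z)"
        by (simp add: sum_distrib_right)
      also have "\<dots> = (\<Sum>(a, b)\<in>divisor_pairs n. (germ_eval (\<alpha> a) z * germ_eval (L a) z) *
          (germ_eval (\<beta> b) z * germ_eval (L b) z))"
        by (rule sum.cong)
          (auto simp: divisor_pairs_iff mult germ_eval_mult[OF _ _ z] c mult_ac simp flip: One_nat_def)
      finally show ?thesis .
    qed
    moreover have "\<alpha> 0 = 0" "\<beta> 0 = 0" using H_set_coeff(1) k0 by auto
    then have "(\<lambda>n. \<Sum>(a, b)\<in>divisor_pairs n. (germ_eval (\<alpha> a) z * germ_eval (L a) z) *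
          (germ_eval (\<beta> b) z * germ_eval (L b) z))
        sums (germ_eval (F_map L \<alpha>) z * germ_eval (F_map L \<beta>) z)"
      using k1 k2 k z by (intro dirichlet_product_sums) auto
    ultimately have "(\<lambda>n. germ_eval (dirichlet_conv \<alpha> \<beta> n) z * germ_eval (L n) z)
        sums germ_eval (F_map L \<alpha> * F_map L \<beta>) z"
      by (simp add: germ_eval_mult[OF hol(1,2) z])
    then show "germ_eval (F_map L (dirichlet_conv \<alpha> \<beta>)) z = germ_eval (F_map L \<alpha> * F_map L \<beta>) z"
      using k3 k(4) z sums_unique2 by blast
  qed
qed

text \<open>The values of \<open>L 1\<close> are idempotent complex numbers and nonzero by the
  definition of \<open>Et_inf\<close>. This is what makes \<open>F_map L\<close> preserve the
  unit.\<close>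

lemma multiplicative_Et_inf_1:
  assumes L: "L \<in> Et_inf" and "\<forall>a\<ge>1. \<forall>b\<ge>1. L (a * b) = L a * L b"
  shows "L 1 = 1"
proof -
  obtain k where k: "\<And>n. L n \<in> hol_germs k" "\<And>n z. n \<ge> 1 \<Longrightarrow> z \<in> halfplane k \<Longrightarrow> germ_eval (L n) z \<noteq> 0"
    using Et_infE[OF L] by metis
  have "L 1 = L 1 * L 1" using assms(2) by (metis le_refl mult_1)
  then have "germ_eval (L 1) z = germ_eval (L 1) z * germ_eval (L 1) z" if "z \<in> halfplane k" for z
    using germ_eval_mult[OF k(1) k(1) that] by metis
  then show ?thesis
    using k(2)[of 1] by (intro germ_eqI[OF k(1) one_in_hol_germs, where m = k]) auto
qed

lemma F_map_one:
  assumes "L 1 = 1"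
  shows "F_map L (\<lambda>n. if n = 1 then 1 else 0) = 1"
proof -
  have "(\<Sum>n. germ_eval (if Suc n = 1 then 1 else 0) z * germ_eval (L (Suc n)) z) = 1" for z
  proof -
    \<comment> \<open>The series is shifted by one, so the only surviving term, that of
      \<open>1\<close>, sits at index \<open>0\<close>.\<close>
    have "(\<lambda>n. germ_eval (if Suc n = 1 then 1 else 0) z * germ_eval (L (Suc n)) z) =
        (\<lambda>n. if n = 0 then 1 else 0)"
      using assms by (auto simp: fun_eq_iff)
    then show ?thesis using sums_unique[OF sums_single[of 0 "\<lambda>_. 1 :: complex"]] by simp
  qed
  then show ?thesis by (simp add: F_map_def one_hgerm_def)
qed

section \<open>Injectivity through exponential decay of the leading coefficient\<close>

text \<open>Dividing the relation \<open>F_L(\<alpha>) = 0\<close> by \<open>L(n\<^sub>0)\<close>, where \<open>\<alpha>(n\<^sub>0)\<close> is the first nonzero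
  coefficient, bounds \<open>|\<alpha>(n\<^sub>0)(x)|\<close> by \<open>M(x) \<Sum>\<^bsub>n > n\<^sub>0\<^esub> n\<^bsup>k - Cx\<^esup>\<close>, which is
  at most a constant times \<open>M(x) 2\<^bsup>- Cx\<^esup>\<close> and hence decays exponentially.\<close>

lemma leading_coeff_in_I_inf:
  assumes L: "L \<in> Et_inf" and \<alpha>: "\<alpha> \<in> H_inf A" and F: "F_map L \<alpha> = 0"
    and n0: "n0 \<ge> 1" and less: "\<And>n. n < n0 \<Longrightarrow> \<alpha> n = 0"
  shows "\<alpha> n0 \<in> I_inf"
proof -
  obtain k where k: "\<alpha> \<in> H_set A k" using \<alpha> by (auto simp: H_inf_def)
  obtain M where M: "continuous_on (halfplane k) M" "\<And>z. z \<in> halfplane k \<Longrightarrow> M z \<ge> 0"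
    "\<And>n z. n \<ge> 1 \<Longrightarrow> z \<in> halfplane k \<Longrightarrow> norm (germ_eval (\<alpha> n) z) \<le> M z * real n powr k"
    "\<forall>a>0. ((\<lambda>x. exp (- a * x) * M (complex_of_real x)) \<longlongrightarrow> 0) at_top"
    using H_setE[OF k] by blast
  obtain l where l: "\<And>n z. n \<ge> 1 \<Longrightarrow> z \<in> halfplane l \<Longrightarrow> germ_eval (L n) z \<noteq> 0"
    and "\<exists>C>0. \<forall>n\<ge>n0 + 1. \<forall>z\<in>halfplane l.
        norm (germ_eval (L n) z) / norm (germ_eval (L n0) z) \<le> real n powr (- C * Re z)"
    using Et_infE[OF L] n0 by metis
  then obtain C where C: "C > 0" "\<And>n z. n \<ge> n0 + 1 \<Longrightarrow> z \<in> halfplane l \<Longrightarrow>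
        norm (germ_eval (L n) z) / norm (germ_eval (L n0) z) \<le> real n powr (- C * Re z)"
    by blast
  obtain k1 where k1: "\<And>z. z \<in> halfplane k1 \<Longrightarrow>
      (\<lambda>n. germ_eval (\<alpha> n) z * germ_eval (L n) z) sums germ_eval (F_map L \<alpha>) z"
    using F_map_sums[OF \<alpha> L] by blast
  \<comment> \<open>Beyond \<open>(k + 2) / C\<close> the exponent \<open>k + 2 - C * x\<close> is
    negative; the summand 2 reserves a factor \<open>n^(-2)\<close> for convergence.\<close>
  define m where "m = Max {k, l, k1, (k + 2) / C}"
  have m: "m \<ge> k" "m \<ge> l" "m \<ge> k1" "m \<ge> (k + 2) / C" by (auto simp: m_def)
  define S where "S = (\<Sum>i. real (Suc i) powr (- 2))"
  have "summable (\<lambda>n. real n powr (- 2))" by (simp add: summable_real_powr_iff)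
  then have summ: "summable (\<lambda>i. real (Suc i) powr (- 2))" by (subst summable_Suc_iff)
  \<comment> \<open>Half the rate of decay: \<open>2 powr (- C * x)\<close> equals
    \<open>exp (- 2 * a * x)\<close>, so after multiplication by \<open>exp (a * x)\<close> a factor
    \<open>exp (- a * x)\<close> remains to control \<open>M\<close>.\<close>
  define a where "a = C * ln 2 / 2"
  have a: "a > 0" using C(1) by (simp add: a_def)
  have bound: "norm (germ_eval (\<alpha> n0) (complex_of_real x)) \<le>
      M (complex_of_real x) * 2 powr (k + 2 - C * x) * S" if x: "x > m" for x
  proof -
    define z where "z = complex_of_real x"
    have z: "z \<in> halfplane k" "z \<in> halfplane l" "z \<in> halfplane k1" "Re z = x"
      using x m by (auto simp: z_def halfplane_def)
    have ex: "k + 2 - C * x \<le> 0"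
    proof -
      have "(k + 2) / C < x" using x m by simp
      then show ?thesis using C(1) by (simp add: field_simps)
    qed
    define v where "v = (\<lambda>n. germ_eval (\<alpha> n) z * germ_eval (L n) z / germ_eval (L n0) z)"
    have "v sums 0"
      unfolding v_def using sums_divide[OF k1[OF z(3)], of "germ_eval (L n0) z"] F by simp
    \<comment> \<open>All terms before \<open>n0\<close> vanish, so the tail beyond
      \<open>n0\<close> must cancel \<open>v n0\<close>, which equals the value of
      \<open>\<alpha> n0\<close> at \<open>z\<close>.\<close>
    moreover have "(\<Sum>i<Suc n0. v i) = v n0"
      using less by (simp add: v_def)
    ultimately have "(\<lambda>i. v (i + Suc n0)) sums (- v n0)"
      using sums_iff_shift[of v "Suc n0" "- v n0"] by simp
    then have "norm (v n0) = norm (\<Sum>i. v (i + Suc n0))"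
      by (simp add: sums_iff)
    also have "\<dots> \<le> (\<Sum>i. M z * 2 powr (k + 2 - C * x) * real (Suc i) powr (- 2))"
    proof (rule norm_suminf_le)
      fix i
      define n where "n = i + Suc n0"
      have n: "n \<ge> n0 + 1" "n \<ge> 2" "n \<ge> 1" "n \<ge> Suc i" using n0 by (auto simp: n_def)
      have "norm (v n) = norm (germ_eval (\<alpha> n) z) *
          (norm (germ_eval (L n) z) / norm (germ_eval (L n0) z))"
        by (simp add: v_def norm_mult norm_divide)
      also have "\<dots> \<le> (M z * real n powr k) * real n powr (- C * x)"
        using M(2,3) C(2)[OF n(1) z(2)] z n by (intro mult_mono) auto
      also have "\<dots> = M z * (real n powr (k + 2 - C * x) * real n powr (- 2))"
        by (simp add: mult.assoc flip: powr_add)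
      \<comment> \<open>Both exponents are nonpositive, so the bases may be lowered:
        \<open>n \<ge> 2\<close> in the first power isolates the decay in \<open>x\<close>, and
        \<open>n \<ge> Suc i\<close> in the second gives a summand of \<open>S\<close>, independent
        of \<open>x\<close>.\<close>
      also have "\<dots> \<le> M z * (2 powr (k + 2 - C * x) * real (Suc i) powr (- 2))"
        using M(2)[OF z(1)] n ex by (intro mult_left_mono mult_mono powr_mono2') auto
      finally show "norm (v (i + Suc n0)) \<le> M z * 2 powr (k + 2 - C * x) * real (Suc i) powr (- 2)"
        by (simp add: n_def mult.assoc)
    qed (intro summable_mult summ)
    also have "\<dots> = M z * 2 powr (k + 2 - C * x) * S"
      unfolding S_def by (rule suminf_mult[OF summ])
    finally show ?thesis
      using l[OF n0 z(2)] by (simp add: v_def z_def)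
  qed
  have "((\<lambda>x. exp (a * x) * norm (germ_eval (\<alpha> n0) (complex_of_real x))) \<longlongrightarrow> 0) at_top"
  proof (rule Lim_null_comparison)
    show "\<forall>\<^sub>F x in at_top. norm (exp (a * x) * norm (germ_eval (\<alpha> n0) (complex_of_real x))) \<le>
        2 powr (k + 2) * S * (exp (- a * x) * M (complex_of_real x))"
      using eventually_gt_at_top[of m]
    proof eventually_elim
      case (elim x)
      have "exp (a * x) * 2 powr (k + 2 - C * x) = 2 powr (k + 2) * exp (- a * x)"
        by (simp add: powr_def a_def algebra_simps flip: exp_add)
      then show ?case
        using mult_left_mono[OF bound[OF elim], of "exp (a * x)"]
        by (simp add: norm_mult mult_ac)
    qed
    show "((\<lambda>x. 2 powr (k + 2) * S * (exp (- a * x) * M (complex_of_real x))) \<longlongrightarrow> 0) at_top"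
      using M(4) a by (intro tendsto_mult_right_zero) blast
  qed
  then have "\<alpha> n0 \<in> I_germs k"
    using a H_set_coeff(3)[OF k] unfolding I_germs_def by blast
  then show ?thesis by (auto simp: I_inf_def)
qed

text \<open>Strong induction: once all earlier coefficients vanish, \<open>\<alpha> n\<close> lies
  in both \<open>A\<close> and \<open>I_inf\<close>, which have no nonzero element in
  common.\<close>

lemma F_map_eq_0_imp:
  assumes A: "A \<subseteq> (B_inf - I_inf) \<union> {0}" and L: "L \<in> Et_inf" and \<alpha>: "\<alpha> \<in> H_inf A"
    and F: "F_map L \<alpha> = 0"
  shows "\<alpha> n = 0"
proof (induction n rule: less_induct)
  case (less n)
  show ?case
  proof (cases "n = 0")
    case True
    then show ?thesis using \<alpha> H_set_coeff(1) by (auto simp: H_inf_def)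
  next
    case False
    then have "\<alpha> n \<in> I_inf" using leading_coeff_in_I_inf[OF L \<alpha> F, of n] less by simp
    moreover have "\<alpha> n \<in> A" using \<alpha> H_set_coeff(2) False by (auto simp: H_inf_def Suc_le_eq)
    ultimately show ?thesis using A by blast
  qed
qed

lemma F_map_inj_on:
  assumes A: "complex_subalgebra A" "A \<subseteq> B_inf" "A \<subseteq> (B_inf - I_inf) \<union> {0}" and L: "L \<in> Et_inf"
  shows "inj_on (F_map L) (H_inf A)"
proof (rule inj_onI)
  fix \<alpha> \<beta> assume \<alpha>: "\<alpha> \<in> H_inf A" and \<beta>: "\<beta> \<in> H_inf A" and eq: "F_map L \<alpha> = F_map L \<beta>"
  \<comment> \<open>The difference is written as \<open>\<alpha>\<close> plus the scalar multiple of
    \<open>\<beta>\<close> by \<open>-1\<close>, so that closure and linearity already proved for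
    sums and scalar multiples apply.\<close>
  have m1: "- 1 \<in> A" using complex_subalgebraD(2,5)[OF A(1)] by blast
  note \<beta>' = H_inf_smult[OF A(1,2) m1 \<beta>]
  have "F_map L (\<lambda>n. \<alpha> n + - 1 * \<beta> n) = 0"
    using F_map_add[OF A(1) L \<alpha> \<beta>'] F_map_smult[OF A(1,2) L m1 \<beta>] eq by simp
  then have "\<alpha> n + - 1 * \<beta> n = 0" for n
    using F_map_eq_0_imp[OF A(3) L H_inf_add[OF A(1) \<alpha> \<beta>']] by blast
  then show "\<alpha> = \<beta>" by (auto simp: fun_eq_iff)
qed

section \<open>Algebra structures\<close>

lemma germ_ring_cring:
  assumes "complex_subalgebra A"
  shows "cring (germ_ring A)"
proof (intro cringI abelian_groupI comm_monoidI)
  fix x assume "x \<in> carrier (germ_ring A)"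
  then show "\<exists>y\<in>carrier (germ_ring A). y \<oplus>\<^bsub>germ_ring A\<^esub> x = \<zero>\<^bsub>germ_ring A\<^esub>"
    using complex_subalgebraD(5)[OF assms] by (intro bexI[of _ "- x"]) (auto simp: germ_ring_def)
qed (auto simp: germ_ring_def algebra_simps intro: complex_subalgebraD[OF assms])

lemma O_alg_algebra:
  assumes "complex_subalgebra A"
  shows "Module.algebra (germ_ring A) O_alg"
proof (intro algebraI germ_ring_cring[OF assms] cringI abelian_groupI comm_monoidI)
  fix x :: hgerm
  show "\<exists>y\<in>carrier O_alg. y \<oplus>\<^bsub>O_alg\<^esub> x = \<zero>\<^bsub>O_alg\<^esub>"
    by (intro bexI[of _ "- x"]) (auto simp: O_alg_def)
qed (auto simp: germ_ring_def O_alg_def algebra_simps)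

lemma H_alg_algebra:
  assumes A: "complex_subalgebra A" "A \<subseteq> B_inf"
  shows "Module.algebra (germ_ring A) (H_alg A)"
proof (intro algebraI germ_ring_cring[OF A(1)] cringI abelian_groupI comm_monoidI)
  fix \<alpha> assume \<alpha>: "\<alpha> \<in> carrier (H_alg A)"
  \<comment> \<open>The additive inverse of \<open>\<alpha>\<close> is its scalar multiple by
    \<open>-1\<close>, which stays in \<open>H_inf A\<close> by closure under scalars.\<close>
  have m1: "- 1 \<in> A" using complex_subalgebraD(2,5)[OF A(1)] by blast
  show "\<exists>\<beta>\<in>carrier (H_alg A). \<beta> \<oplus>\<^bsub>H_alg A\<^esub> \<alpha> = \<zero>\<^bsub>H_alg A\<^esub>"
    using H_inf_smult[OF A m1, of \<alpha>] \<alpha>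
    by (intro bexI[of _ "\<lambda>n. - 1 * \<alpha> n"]) (auto simp: H_alg_def)
  show "\<one>\<^bsub>H_alg A\<^esub> \<otimes>\<^bsub>H_alg A\<^esub> \<alpha> = \<alpha>"
    using \<alpha> dirichlet_conv_one_left[of \<alpha>] H_set_coeff(1) by (auto simp: H_alg_def H_inf_def)
  show "\<alpha> \<otimes>\<^bsub>H_alg A\<^esub> \<beta> = \<beta> \<otimes>\<^bsub>H_alg A\<^esub> \<alpha>" for \<beta>
    by (simp add: H_alg_def dirichlet_conv_commute)
qed (use H_inf_zero[OF A(1)] H_inf_one[OF A(1)] H_inf_add[OF A(1)] H_inf_smult[OF A]
       H_inf_dirichlet_conv[OF A(1)]
     in \<open>auto simp: H_alg_def germ_ring_def dirichlet_conv_assoc dirichlet_conv_add_left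
       dirichlet_conv_smult_left algebra_simps\<close>)

theorem theorem2p7:
  fixes A :: "hgerm set" and L :: "nat \<Rightarrow> hgerm"
  assumes "complex_subalgebra A" and "A \<subseteq> B_inf"
    and "A \<subseteq> (B_inf - I_inf) \<union> {0}"
    and "L \<in> Et_inf"
  shows "(module_morphism (germ_ring A) (H_alg A) O_alg (F_map L) \<and>
           inj_on (F_map L) (carrier (H_alg A))) \<and>
         ((\<forall>a\<ge>1. \<forall>b\<ge>1. L (a * b) = L a * L b) \<and> L \<noteq> (\<lambda>_. 0) \<longrightarrow>
           algebra_morphism (germ_ring A) (H_alg A) O_alg (F_map L) \<and>
           inj_on (F_map L) (carrier (H_alg A)))"
proof (intro conjI impI)
  note alg = H_alg_algebra[OF assms(1,2)] O_alg_algebra[OF assms(1)]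
  have mods: "Module.module (germ_ring A) (H_alg A)" "Module.module (germ_ring A) O_alg"
    using alg by (auto simp: Module.algebra_def)
  have add: "F_map L (\<alpha> \<oplus>\<^bsub>H_alg A\<^esub> \<beta>) = F_map L \<alpha> \<oplus>\<^bsub>O_alg\<^esub> F_map L \<beta>"
    if "\<alpha> \<in> carrier (H_alg A)" "\<beta> \<in> carrier (H_alg A)" for \<alpha> \<beta>
    using F_map_add[OF assms(1,4)] that by (simp add: H_alg_def O_alg_def)
  have smult: "F_map L (f \<odot>\<^bsub>H_alg A\<^esub> \<alpha>) = f \<odot>\<^bsub>O_alg\<^esub> F_map L \<alpha>"
    if "f \<in> carrier (germ_ring A)" "\<alpha> \<in> carrier (H_alg A)" for f \<alpha>
    using F_map_smult[OF assms(1,2,4)] that by (simp add: H_alg_def O_alg_def germ_ring_def)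
  show "module_morphism (germ_ring A) (H_alg A) O_alg (F_map L)"
    unfolding module_morphism_def using mods add smult by (auto simp: O_alg_def)
  show inj: "inj_on (F_map L) (carrier (H_alg A))"
    using F_map_inj_on[OF assms] by (simp add: H_alg_def)
  then show "inj_on (F_map L) (carrier (H_alg A))" .
  assume "(\<forall>a\<ge>1. \<forall>b\<ge>1. L (a * b) = L a * L b) \<and> L \<noteq> (\<lambda>_. 0)"
  then have mult: "\<forall>a\<ge>1. \<forall>b\<ge>1. L (a * b) = L a * L b"
    by blast
  have "F_map L \<in> ring_hom (H_alg A) O_alg"
  proof (rule ring_hom_memI)
    \<comment> \<open>The unit is sent to \<open>L 1\<close>, which multiplicativity and the absence
      of zeros force to be \<open>1\<close>.\<close>
    show "F_map L \<one>\<^bsub>H_alg A\<^esub> = \<one>\<^bsub>O_alg\<^esub>"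
      using F_map_one[of L, OF multiplicative_Et_inf_1[OF assms(4) mult]] by (simp add: H_alg_def O_alg_def)
  qed (use add F_map_dirichlet_conv[OF assms(1,4) mult] in \<open>auto simp: H_alg_def O_alg_def\<close>)
  then show "algebra_morphism (germ_ring A) (H_alg A) O_alg (F_map L)"
    unfolding algebra_morphism_def using alg smult by blast
qed

end
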